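(* Consider the hybrid mechanical system and the quadrature variable $z(t,\rho)$ described in the context, with an event at time $t_{\rm eve}=t_{\rm eve}(\rho)$. Let $Z|_{t_{\rm eve}}^{+}$ and $Z|_{t_{\rm eve}}^{-}$ (row vectors in $\mathbb{R}^{1\times p}$) be the sensitivities of the quadrature variable with respect to the parameters right after and right before the event, and let $$g|_{t_{\rm eve}}^{+}:=\tilde g\big(t_{\rm eve},q|_{t_{\rm eve}},v|_{t_{\rm eve}}^{+},\rho\big),\qquad g|_{t_{\rm eve}}^{-}:=\tilde g\big(t_{\rm eve},q|_{t_{\rm eve}},v|_{t_{\rm eve}}^{-},\rho\big)$$ be the running cost function evaluated right after and right before the event. Then $$Z|_{t_{\rm eve}}^{+}=Z|_{t_{\rm eve}}^{-}-\Big(g|_{t_{\rm eve}}^{+}-g|_{t_{\rm eve}}^{-}\Big)\cdot\frac{dt_{\rm eve}}{d\rho}.$$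
   Context: System. $q\in\mathbb{R}^n$ is the generalized position, $v=\dot q\in\mathbb{R}^n$ the generalized velocity, $\rho\in\mathbb{R}^p$ the parameter vector. Away from events, $\dot q=v$, $\dot v=f^{\rm eom}(t,q,v,\rho)=\mathsf{M}^{-1}(t,q,\rho)\,\mathsf{F}(t,q,v,\rho)$ for $t_0\le t\le t_F$, with initial conditions $q(t_0)=q_0(\rho)$, $v(t_0)=v_0(\rho)$ depending differentiably on $\rho$. The mass matrix $\mathsf M$ is $n\times n$ and invertible; $\mathsf M$, $\mathsf M^{-1}$ and $\mathsf F$ are smooth in all arguments. The solution is written $q(t,\rho)$, $v(t,\rho)$. Event. There are finitely many events along the trajectory (no Zeno behavior); the result concerns one of them, isolated in time. The event time $t_{\rm eve}(\rho)$ is determined by $r\big(q(t_{\rm eve}(\rho),\rho)\big)=0$, where $r:\mathbb{R}^n\to\mathbb{R}$ is a smooth event function. There is no grazing: the trajectory does not touch the event surface tangentially, i.e. $\frac{dr}{dq}(q|_{t_{\rm eve}})\cdot v|_{t_{\rm eve}}^{-}\neq 0$. The row vector $\frac{dt_{\rm eve}}{d\rho}\in\mathbb{R}^{1\times p}$ is the derivative of $t_{\rm eve}(\rho)$. One-sided values. For any quantity $x$, $x|_{t_{\rm eve}}^{\pm}=\lim_{\varepsilon\downarrow 0}x(t_{\rm eve}\pm\varepsilon)$; the evolution is smooth in time on each side of the event. At the event the position is continuous, $q|_{t_{\rm eve}}^{+}=q|_{t_{\rm eve}}^{-}=q|_{t_{\rm eve}}$, while the velocity may jump according to $v|_{t_{\rm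 eve}}^{+}=h\big(t_{\rm eve},q|_{t_{\rm eve}},v|_{t_{\rm eve}}^{-},\rho\big)$ with $h$ a smooth jump function. Running cost and quadrature variable. $g(t,q,v,\dot v,\rho)\in\mathbb{R}$ is a smooth trajectory (running) cost function, and $\tilde g(t,q,v,\rho):=g\big(t,q,v,f^{\rm eom}(t,q,v,\rho),\rho\big)$. The quadrature variable is $z(t,\rho)=\int_{t_0}^{t}\tilde g\big(s,q(s,\rho),v(s,\rho),\rho\big)\,ds$; it is continuous in time. Its sensitivity is $Z(t,\rho)=\frac{\partial z}{\partial\rho}(t,\rho)\in\mathbb{R}^{1\times p}$ (derivative at fixed $t$), and $Z|^\pm_{t_{\rm eve}}$ are its one-sided limits in $t$ at the event. *)

theory Defs
  imports "HOL-Analysis.Analysis"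
begin

fun cont_diff :: "nat \<Rightarrow> ('a::euclidean_space \<Rightarrow> 'b::real_normed_vector) \<Rightarrow> bool" where
  "cont_diff 0 f \<longleftrightarrow> continuous_on UNIV f"
| "cont_diff (Suc k) f \<longleftrightarrow>
     (\<forall>x. f differentiable (at x)) \<and>
     (\<forall>b\<in>Basis. cont_diff k (\<lambda>x. frechet_derivative f (at x) b))"

text \<open>Smooth means of class C-infinity, jointly in all arguments; functions of several
  arguments are uncurried before they are passed to \<open>smooth\<close>.\<close>

definition smooth :: "('a::euclidean_space \<Rightarrow> 'b::real_normed_vector) \<Rightarrow> bool" where
  "smooth f \<longleftrightarrow> (\<forall>k. cont_diff k f)"

definition f_eom ::
  "(real \<Rightarrow> real^'n \<Rightarrow> real^'p \<Rightarrow> real^'n^'n) \<Rightarrow>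
   (real \<Rightarrow> real^'n \<Rightarrow> real^'n \<Rightarrow> real^'p \<Rightarrow> real^'n) \<Rightarrow>
   real \<Rightarrow> real^'n \<Rightarrow> real^'n \<Rightarrow> real^'p \<Rightarrow> real^'n" where
  "f_eom M F t q v \<rho> = matrix_inv (M t q \<rho>) *v F t q v \<rho>"

definition g_tilde ::
  "(real \<Rightarrow> real^'n \<Rightarrow> real^'p \<Rightarrow> real^'n^'n) \<Rightarrow>
   (real \<Rightarrow> real^'n \<Rightarrow> real^'n \<Rightarrow> real^'p \<Rightarrow> real^'n) \<Rightarrow>
   (real \<Rightarrow> real^'n \<Rightarrow> real^'n \<Rightarrow> real^'n \<Rightarrow> real^'p \<Rightarrow> real) \<Rightarrow>
   real \<Rightarrow> real^'n \<Rightarrow> real^'n \<Rightarrow> real^'p \<Rightarrow> real" where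
  "g_tilde M F g t q v \<rho> = g t q v (f_eom M F t q v \<rho>) \<rho>"

text \<open>Since \<open>z\<close> is defined by an integral over time, the arbitrary value of \<open>v\<close> at the event
  times themselves does not matter.\<close>

definition quadrature ::
  "(real \<Rightarrow> real^'n \<Rightarrow> real^'p \<Rightarrow> real^'n^'n) \<Rightarrow>
   (real \<Rightarrow> real^'n \<Rightarrow> real^'n \<Rightarrow> real^'p \<Rightarrow> real^'n) \<Rightarrow>
   (real \<Rightarrow> real^'n \<Rightarrow> real^'n \<Rightarrow> real^'n \<Rightarrow> real^'p \<Rightarrow> real) \<Rightarrow>
   real \<Rightarrow> (real \<Rightarrow> real^'p \<Rightarrow> real^'n) \<Rightarrow> (real \<Rightarrow> real^'p \<Rightarrow> real^'n) \<Rightarrow>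
   real \<Rightarrow> real^'p \<Rightarrow> real" where
  "quadrature M F g t0 q v t \<rho> = integral {t0..t} (\<lambda>s. g_tilde M F g s (q s \<rho>) (v s \<rho>) \<rho>)"

text \<open>The family of trajectories, for parameters in an open set \<open>P\<close>, has finitely many events,
  the \<open>i\<close>-th one (\<open>i < N\<close>) at time \<open>te i \<rho>\<close>. Each event may have its own event function \<open>r i\<close>
  and jump function \<open>h i\<close>; a single pair of functions is the case of constant families.\<close>

locale hybrid_mechanical_system =
  fixes M :: "real \<Rightarrow> real^'n \<Rightarrow> real^'p \<Rightarrow> real^'n^'n"
    and F :: "real \<Rightarrow> real^'n \<Rightarrow> real^'n \<Rightarrow> real^'p \<Rightarrow> real^'n"
    and t0 tF :: real
    and P :: "(real^'p) set"
    and q0 v0 :: "real^'p \<Rightarrow> real^'n"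
    and N :: nat
    and r :: "nat \<Rightarrow> real^'n \<Rightarrow> real"
    and h :: "nat \<Rightarrow> real \<Rightarrow> real^'n \<Rightarrow> real^'n \<Rightarrow> real^'p \<Rightarrow> real^'n"
    and te :: "nat \<Rightarrow> real^'p \<Rightarrow> real"
    and q v :: "real \<Rightarrow> real^'p \<Rightarrow> real^'n"
  assumes mass_invertible: "\<And>t x \<rho>. invertible (M t x \<rho>)"
    and mass_smooth: "smooth (\<lambda>(t, x, \<rho>). M t x \<rho>)"
    and mass_inv_smooth: "smooth (\<lambda>(t, x, \<rho>). matrix_inv (M t x \<rho>))"
    and force_smooth: "smooth (\<lambda>(t, x, w, \<rho>). F t x w \<rho>)"
    and event_smooth: "\<And>i. i < N \<Longrightarrow> smooth (r i)"
    and jump_smooth: "\<And>i. i < N \<Longrightarrow> smooth (\<lambda>(t, x, w, \<rho>). h i t x w \<rho>)"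
    and params_open: "open P"
    and init_differentiable: "q0 differentiable_on P" "v0 differentiable_on P"
    and time_order: "t0 < tF"
    and event_in_range: "\<And>i \<rho>. i < N \<Longrightarrow> \<rho> \<in> P \<Longrightarrow> t0 < te i \<rho> \<and> te i \<rho> < tF"
    and events_ordered: "\<And>i j \<rho>. i < j \<Longrightarrow> j < N \<Longrightarrow> \<rho> \<in> P \<Longrightarrow> te i \<rho> < te j \<rho>"
    and event_time_differentiable: "\<And>i. i < N \<Longrightarrow> te i differentiable_on P"
    and init: "\<And>\<rho>. \<rho> \<in> P \<Longrightarrow> q t0 \<rho> = q0 \<rho>" "\<And>\<rho>. \<rho> \<in> P \<Longrightarrow> v t0 \<rho> = v0 \<rho>"
    and position_continuous: "\<And>\<rho>. \<rho> \<in> P \<Longrightarrow> continuous_on {t0..tF} (\<lambda>t. q t \<rho>)"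
    and position_eom: "\<And>\<rho> t. \<rho> \<in> P \<Longrightarrow> t \<in> {t0..tF} \<Longrightarrow> (\<And>i. i < N \<Longrightarrow> t \<noteq> te i \<rho>) \<Longrightarrow>
      ((\<lambda>t. q t \<rho>) has_vector_derivative v t \<rho>) (at t within {t0..tF})"
    and velocity_eom: "\<And>\<rho> t. \<rho> \<in> P \<Longrightarrow> t \<in> {t0..tF} \<Longrightarrow> (\<And>i. i < N \<Longrightarrow> t \<noteq> te i \<rho>) \<Longrightarrow>
      ((\<lambda>t. v t \<rho>) has_vector_derivative f_eom M F t (q t \<rho>) (v t \<rho>) \<rho>) (at t within {t0..tF})"
    and event_condition: "\<And>i \<rho>. i < N \<Longrightarrow> \<rho> \<in> P \<Longrightarrow> r i (q (te i \<rho>) \<rho>) = 0"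
    and event_transition: "\<And>i \<rho>. i < N \<Longrightarrow> \<rho> \<in> P \<Longrightarrow>
      \<exists>vm. ((\<lambda>t. v t \<rho>) \<longlongrightarrow> vm) (at_left (te i \<rho>)) \<and>
           frechet_derivative (r i) (at (q (te i \<rho>) \<rho>)) vm \<noteq> 0 \<and>
           ((\<lambda>t. v t \<rho>) \<longlongrightarrow> h i (te i \<rho>) (q (te i \<rho>) \<rho>) vm \<rho>) (at_right (te i \<rho>))"

end

theory Submission
  imports Defs
begin

text \<open>Differentiate \<open>\<rho> \<mapsto> z (t_eve \<rho>) \<rho>\<close> at the parameter in question. Approaching the event from
  the left, the gradient is \<open>Z\<^sup>- + g\<^sup>- dt_eve/d\<rho>\<close>; approaching it from the right, it is
  \<open>Z\<^sup>+ + g\<^sup>+ dt_eve/d\<rho>\<close>; uniqueness of the gradient gives the jump condition. To justify each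
  one-sided formula one rescales every segment between events to the unit interval, where the
  trajectories for different parameters jump at the same instants. Gronwall's inequality on
  each segment and the Lipschitz continuity of the jumps show, by induction over the events, that
  the rescaled trajectory deviates from the reference one by \<open>O(\<bar>\<delta>\<rho>\<bar>)\<close> uniformly in time.\<close>

subsection \<open>Functions that are Lipschitz on bounded sets\<close>

text \<open>At the event time itself \<open>z(., t)\<close> may have a kink in the parameter,
  because a perturbed trajectory can meet its event earlier or later; the gradient \<open>Z\<close>
  is therefore available only at nearby times. Evaluating at the moving event time avoids the kink,
  but then a short integral, from a fixed nearby time to the moving endpoint, has to be controlled
  to first order in the parameter change. Continuous dependence alone would give o(1) where
  o(|change|) is required. A deviation O(|change|), uniform in the rescaled time, is enough: over a
  rescaled interval of length \<delta> the integral then changes by O(\<delta> |change|), apart from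
  the displacement of its ends, and \<delta> can be chosen small. So the flow is only estimated,
  never linearized. All estimates compare with one reference parameter, since differentiability of
  the event times, without continuity of their derivatives, gives only such estimates.\<close>

definition lipschitz_on_bounded :: "('a::euclidean_space \<Rightarrow> 'b::real_normed_vector) \<Rightarrow> bool" where
  "lipschitz_on_bounded f \<longleftrightarrow> (\<forall>S. bounded S \<longrightarrow> (\<exists>L. L-lipschitz_on S f))"

lemma bounded_image_lipschitz:
  assumes "L-lipschitz_on S f" "bounded S"
  shows "bounded (f ` S)"
proof (cases "S = {}")
  case False
  then obtain a where a: "a \<in> S" by blast
  obtain B where B: "\<And>x. x \<in> S \<Longrightarrow> dist a x \<le> B"
    using assms(2) unfolding bounded_any_center[of S a] by blast
  have "dist (f a) (f x) \<le> L * B" if "x \<in> S" for x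
    using lipschitz_onD[OF assms(1) a that] mult_left_mono[OF B[OF that] lipschitz_on_nonneg[OF assms(1)]]
    by linarith
  then show ?thesis
    unfolding bounded_any_center[of _ "f a"] by blast
qed simp

lemma lipschitz_on_bounded_continuous_on:
  assumes "lipschitz_on_bounded f"
  shows "continuous_on S f"
proof -
  have "isCont f x" for x
  proof -
    obtain L where "L-lipschitz_on (ball x 1) f"
      using assms bounded_ball unfolding lipschitz_on_bounded_def by blast
    then have "continuous_on (ball x 1) f"
      by (rule lipschitz_on_continuous_on)
    then show ?thesis
      by (simp add: continuous_on_eq_continuous_at)
  qed
  then show ?thesis
    by (simp add: continuous_at_imp_continuous_on)
qed

lemma lipschitz_on_bounded_linear:
  assumes "bounded_linear f"
  shows "lipschitz_on_bounded f"
proof -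
  obtain B where "B-lipschitz_on UNIV f"
    using bounded_linear.lipschitz_boundE[OF assms] by blast
  then show ?thesis
    unfolding lipschitz_on_bounded_def using lipschitz_on_subset by blast
qed

lemma lipschitz_on_bounded_compose:
  fixes g :: "'a::euclidean_space \<Rightarrow> 'b::euclidean_space" and f :: "'b \<Rightarrow> 'c::real_normed_vector"
  assumes "lipschitz_on_bounded f" "lipschitz_on_bounded g"
  shows "lipschitz_on_bounded (\<lambda>x. f (g x))"
  unfolding lipschitz_on_bounded_def
proof (intro allI impI)
  fix S :: "'a set" assume S: "bounded S"
  obtain L where L: "L-lipschitz_on S g"
    using assms(2) S unfolding lipschitz_on_bounded_def by blast
  obtain K where "K-lipschitz_on (g ` S) f"
    using assms(1) bounded_image_lipschitz[OF L S] unfolding lipschitz_on_bounded_def by blast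
  from lipschitz_on_compose2[OF L this] show "\<exists>L. L-lipschitz_on S (\<lambda>x. f (g x))"
    by blast
qed

lemma lipschitz_on_bounded_Pair:
  assumes "lipschitz_on_bounded f" "lipschitz_on_bounded g"
  shows "lipschitz_on_bounded (\<lambda>x. (f x, g x))"
  unfolding lipschitz_on_bounded_def
proof (intro allI impI)
  fix S :: "'a set" assume S: "bounded S"
  obtain L K where "L-lipschitz_on S f" "K-lipschitz_on S g"
    using assms S unfolding lipschitz_on_bounded_def by blast
  from lipschitz_on_Pair[OF this] show "\<exists>L. L-lipschitz_on S (\<lambda>x. (f x, g x))"
    by blast
qed

text \<open>A product is Lipschitz only as long as both factors stay bounded, which is why the
  Lipschitz property is asked for on bounded sets and not globally.\<close>

lemma lipschitz_on_bounded_bilinear: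
  fixes bl :: "'a::euclidean_space \<Rightarrow> 'b::euclidean_space \<Rightarrow> 'c::real_normed_vector"
  assumes "bounded_bilinear bl"
  shows "lipschitz_on_bounded (\<lambda>(x, y). bl x y)"
  unfolding lipschitz_on_bounded_def
proof (intro allI impI)
  fix S :: "('a \<times> 'b) set" assume "bounded S"
  then obtain B where B: "\<And>z. z \<in> S \<Longrightarrow> norm z \<le> B" "B > 0"
    by (auto simp: bounded_pos)
  obtain K where K: "K \<ge> 0" "\<And>x y. norm (bl x y) \<le> norm x * norm y * K"
    using bounded_bilinear.nonneg_bounded[OF assms] by blast
  have "dist (case z of (x, y) \<Rightarrow> bl x y) (case z' of (x, y) \<Rightarrow> bl x y) \<le> (2 * (B * K)) * dist z z'"
    if "z \<in> S" "z' \<in> S" for z z'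
  proof -
    obtain x y x' y' where z: "z = (x, y)" "z' = (x', y')" by fastforce
    have le: "norm y \<le> B" "norm x' \<le> B"
      using B(1)[OF that(1)] B(1)[OF that(2)] norm_snd_le[of y x] norm_fst_le[of x' y']
      unfolding z by linarith+
    have d: "norm (x - x') \<le> dist z z'" "norm (y - y') \<le> dist z z'"
      unfolding z dist_norm using norm_fst_le[of "x - x'" "y - y'"] norm_snd_le[of "y - y'" "x - x'"]
      by auto
    have "bl x y - bl x' y' = bl (x - x') y + bl x' (y - y')"
      by (simp add: bounded_bilinear.diff_left[OF assms] bounded_bilinear.diff_right[OF assms])
    then have "norm (bl x y - bl x' y') \<le> norm (x - x') * norm y * K + norm x' * norm (y - y') * K"
      using norm_triangle_le K(2) add_mono by metis
    also have "\<dots> \<le> dist z z' * B * K + B * dist z z' * K"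
      using le d K(1) B(2) by (intro add_mono mult_right_mono mult_mono) auto
    finally show ?thesis
      by (simp add: z dist_norm algebra_simps)
  qed
  moreover have "0 \<le> 2 * (B * K)"
    using K(1) B(2) by simp
  ultimately show "\<exists>L. L-lipschitz_on S (\<lambda>(x, y). bl x y)"
    by (blast intro: lipschitz_onI)
qed

lemma lipschitz_on_bounded_bilinear_compose:
  fixes bl :: "'a::euclidean_space \<Rightarrow> 'b::euclidean_space \<Rightarrow> 'c::real_normed_vector"
    and f :: "'d::euclidean_space \<Rightarrow> 'a"
  assumes "bounded_bilinear bl" "lipschitz_on_bounded f" "lipschitz_on_bounded g"
  shows "lipschitz_on_bounded (\<lambda>x. bl (f x) (g x))"
  using lipschitz_on_bounded_compose[OF lipschitz_on_bounded_bilinear[OF assms(1)]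
      lipschitz_on_bounded_Pair[OF assms(2,3)]] by simp

lemma lipschitz_on_bounded_fst: "lipschitz_on_bounded fst"
  and lipschitz_on_bounded_snd: "lipschitz_on_bounded snd"
  by (auto intro: lipschitz_on_bounded_linear bounded_linear_fst bounded_linear_snd)

lemma lipschitz_on_bounded_const: "lipschitz_on_bounded (\<lambda>_. a)"
  unfolding lipschitz_on_bounded_def using lipschitz_on_constant by blast

lemma lipschitz_on_bounded_add:
  fixes f :: "'a::euclidean_space \<Rightarrow> 'b::euclidean_space"
  assumes "lipschitz_on_bounded f" "lipschitz_on_bounded g"
  shows "lipschitz_on_bounded (\<lambda>x. f x + g x)"
  unfolding lipschitz_on_bounded_def
proof (intro allI impI)
  fix S :: "'a set" assume S: "bounded S"
  obtain L K where "L-lipschitz_on S f" "K-lipschitz_on S g"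
    using assms S unfolding lipschitz_on_bounded_def by blast
  from lipschitz_on_add[OF this] show "\<exists>L. L-lipschitz_on S (\<lambda>x. f x + g x)"
    by blast
qed

text \<open>Continuous partial derivatives are bounded on a closed ball, the sum of their bounds
  dominates the operator norm, and the mean value inequality turns this into a Lipschitz
  constant.\<close>

lemma smooth_lipschitz_on_bounded:
  fixes f :: "'a::euclidean_space \<Rightarrow> 'b::real_normed_vector"
  assumes "smooth f"
  shows "lipschitz_on_bounded f"
  unfolding lipschitz_on_bounded_def
proof (intro allI impI)
  fix S :: "'a set" assume "bounded S"
  then obtain R where "\<And>x. x \<in> S \<Longrightarrow> norm x \<le> R"
    unfolding bounded_iff by blast
  \<comment> \<open>\<open>S\<close> may be neither convex nor compact; the ball around it is
    both.\<close>
  then have R: "S \<subseteq> cball 0 R"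
    by auto
  have "cont_diff (Suc 0) f"
    using assms unfolding smooth_def by blast
  then have diff: "\<And>x. f differentiable (at x)"
    and cont: "\<And>b. b \<in> Basis \<Longrightarrow> continuous_on UNIV (\<lambda>x. frechet_derivative f (at x) b)"
    by auto
  have "\<exists>B. \<forall>x\<in>cball 0 R. norm (frechet_derivative f (at x) b) \<le> B" if "b \<in> Basis" for b
  proof -
    have "compact ((\<lambda>x. frechet_derivative f (at x) b) ` cball 0 R)"
      by (intro compact_continuous_image continuous_on_subset[OF cont[OF that]]) auto
    then have "bounded ((\<lambda>x. frechet_derivative f (at x) b) ` cball 0 R)"
      by (rule compact_imp_bounded)
    then show ?thesis
      unfolding bounded_iff by (simp only: ball_simps)
  qed
  then have "\<exists>B. \<forall>b\<in>Basis. \<forall>x\<in>cball 0 R. norm (frechet_derivative f (at x) b) \<le> B b"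
    by (intro bchoice ballI)
  then obtain B where B: "\<And>b x. b \<in> Basis \<Longrightarrow> x \<in> cball 0 R \<Longrightarrow> norm (frechet_derivative f (at x) b) \<le> B b"
    by blast
  have deriv: "(f has_derivative frechet_derivative f (at x)) (at x)" for x
    using diff frechet_derivative_works by blast
  have "onorm (frechet_derivative f (at x)) \<le> (\<Sum>b\<in>Basis. \<bar>B b\<bar>)" if x: "x \<in> cball 0 R" for x
  proof (rule onorm_bound)
    fix h
    have lin: "linear (frechet_derivative f (at x))"
      using deriv has_derivative_linear by blast
    have "frechet_derivative f (at x) h = frechet_derivative f (at x) (\<Sum>b\<in>Basis. (h \<bullet> b) *\<^sub>R b)"
      by (simp add: euclidean_representation)
    also have "\<dots> = (\<Sum>b\<in>Basis. (h \<bullet> b) *\<^sub>R frechet_derivative f (at x) b)"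
      by (simp add: linear_sum[OF lin] linear_scale[OF lin])
    also have "norm \<dots> \<le> (\<Sum>b\<in>Basis. \<bar>B b\<bar> * norm h)"
    proof (rule sum_norm_le)
      fix b :: 'a assume b: "b \<in> Basis"
      have "\<bar>h \<bullet> b\<bar> * norm (frechet_derivative f (at x) b) \<le> norm h * \<bar>B b\<bar>"
        using Basis_le_norm[OF b, of h] B[OF b x] by (intro mult_mono) auto
      then show "norm ((h \<bullet> b) *\<^sub>R frechet_derivative f (at x) b) \<le> \<bar>B b\<bar> * norm h"
        by (simp add: mult.commute)
    qed
    finally show "norm (frechet_derivative f (at x) h) \<le> (\<Sum>b\<in>Basis. \<bar>B b\<bar>) * norm h"
      by (simp add: sum_distrib_right)
  qed (simp add: sum_nonneg)
  then have "(\<Sum>b\<in>Basis. \<bar>B b\<bar>)-lipschitz_on (cball 0 R) f"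
    by (intro bounded_derivative_imp_lipschitz[where f' = "\<lambda>x. frechet_derivative f (at x)"]
        has_derivative_at_withinI[OF deriv]) (auto simp: sum_nonneg)
  then show "\<exists>L. L-lipschitz_on S f"
    using lipschitz_on_subset R by blast
qed

subsection \<open>Calmness: Lipschitz estimates with one endpoint fixed\<close>

text \<open>One endpoint is the fixed \<open>p\<close>, because differentiability at a single point
  yields this and not an estimate between two varying parameters. Both \<open>C\<close> and the
  neighbourhood are uniform in the auxiliary variable \<open>s\<close>. As \<open>p\<close> belongs
  to each of its neighbourhoods, eventual facts also hold at \<open>p\<close> itself.\<close>

definition calm_on :: "'s set \<Rightarrow> ('p::real_normed_vector \<Rightarrow> 's \<Rightarrow> 'b::real_normed_vector) \<Rightarrow> 'p \<Rightarrow> bool" where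
  "calm_on S f p \<longleftrightarrow>
    (\<exists>C. \<forall>\<^sub>F p' in nhds p. \<forall>s\<in>S. norm (f p' s - f p s) \<le> C * norm (p' - p))"

lemma calm_onE:
  assumes "calm_on S f p"
  obtains C where "C > 0" "\<forall>\<^sub>F p' in nhds p. \<forall>s\<in>S. norm (f p' s - f p s) \<le> C * norm (p' - p)"
proof -
  obtain C where C: "\<forall>\<^sub>F p' in nhds p. \<forall>s\<in>S. norm (f p' s - f p s) \<le> C * norm (p' - p)"
    using assms unfolding calm_on_def by blast
  have "\<forall>\<^sub>F p' in nhds p. \<forall>s\<in>S. norm (f p' s - f p s) \<le> max C 1 * norm (p' - p)"
    using C
  proof eventually_elim
    case (elim p')
    then show ?case
      using mult_right_mono[OF max.cobounded1 norm_ge_zero] order_trans by blast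
  qed
  with that[of "max C 1"] show thesis by simp
qed

lemma calm_onI:
  "\<forall>\<^sub>F p' in nhds p. \<forall>s\<in>S. norm (f p' s - f p s) \<le> C * norm (p' - p) \<Longrightarrow> calm_on S f p"
  unfolding calm_on_def by blast

lemma calm_on_const: "calm_on S (\<lambda>_. f) p"
  by (rule calm_onI[where C = 0]) simp

lemma calm_on_ident: "calm_on S (\<lambda>p s. p) p"
  by (rule calm_onI[where C = 1]) simp

lemma eventually_norm_diff_less:
  "e > 0 \<Longrightarrow> \<forall>\<^sub>F x in nhds a. norm (x - a) < e"
  unfolding eventually_nhds_metric dist_norm by blast

lemma calm_on_differentiable:
  fixes f :: "'a::real_normed_vector \<Rightarrow> 'b::real_normed_vector"
  assumes "f differentiable (at p)"
  shows "calm_on S (\<lambda>p s. f p) p"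
proof -
  obtain f' where f': "(f has_derivative f') (at p)"
    using assms unfolding differentiable_def by blast
  obtain K where K: "\<And>x. norm (f' x) \<le> norm x * K"
    using bounded_linear.bounded[OF has_derivative_bounded_linear[OF f']] by blast
  \<comment> \<open>The tolerance 1 is arbitrary; it becomes the 1 in the constant
    \<open>1 + K\<close>.\<close>
  obtain d where d: "d > 0" "\<And>y. norm (y - p) < d \<Longrightarrow> norm (f y - f p - f' (y - p)) \<le> 1 * norm (y - p)"
    using f' unfolding has_derivative_at_alt by (metis zero_less_one)
  have "\<forall>\<^sub>F p' in nhds p. \<forall>s\<in>S. norm (f p' - f p) \<le> (1 + K) * norm (p' - p)"
    using eventually_norm_diff_less[OF d(1), of p]
  proof eventually_elim
    case (elim y)
    have "norm (f y - f p) \<le> norm (f y - f p - f' (y - p)) + norm (f' (y - p))"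
      by norm
    then show ?case
      using d(2)[OF elim] K[of "y - p"] by (simp add: algebra_simps)
  qed
  then show ?thesis by (rule calm_onI)
qed

lemma calm_on_eventually_close:
  assumes "calm_on S f p" "e > 0"
  shows "\<forall>\<^sub>F p' in nhds p. \<forall>s\<in>S. norm (f p' s - f p s) < e"
proof -
  obtain C where C: "C > 0" "\<forall>\<^sub>F p' in nhds p. \<forall>s\<in>S. norm (f p' s - f p s) \<le> C * norm (p' - p)"
    using calm_onE[OF assms(1)] .
  have "e / C > 0" using assms(2) C(1) by simp
  from C(2) eventually_norm_diff_less[OF this, of p] show ?thesis
  proof eventually_elim
    case (elim p')
    then have "C * norm (p' - p) < e"
      using C(1) by (simp add: field_simps)
    with elim(1) show ?case by fastforce
  qed
qed

lemma calm_on_Pair: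
  assumes "calm_on S f p" "calm_on S g p"
  shows "calm_on S (\<lambda>p s. (f p s, g p s)) p"
proof -
  obtain C where C: "\<forall>\<^sub>F p' in nhds p. \<forall>s\<in>S. norm (f p' s - f p s) \<le> C * norm (p' - p)"
    using assms(1) unfolding calm_on_def by blast
  obtain D where D: "\<forall>\<^sub>F p' in nhds p. \<forall>s\<in>S. norm (g p' s - g p s) \<le> D * norm (p' - p)"
    using assms(2) unfolding calm_on_def by blast
  from C D have "\<forall>\<^sub>F p' in nhds p. \<forall>s\<in>S. norm ((f p' s, g p' s) - (f p s, g p s)) \<le> (C + D) * norm (p' - p)"
  proof eventually_elim
    case (elim p')
    show ?case
    proof
      fix s assume "s \<in> S"
      then show "norm ((f p' s, g p' s) - (f p s, g p s)) \<le> (C + D) * norm (p' - p)"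
        using elim norm_Pair_le[of "f p' s - f p s" "g p' s - g p s"]
        by (fastforce simp: algebra_simps)
    qed
  qed
  then show ?thesis by (rule calm_onI)
qed

text \<open>Boundedness of \<open>f p\<close> on \<open>S\<close> confines all values, for
  \<open>p'\<close> close to \<open>p\<close>, to one ball, so a single Lipschitz constant of
  \<open>c\<close> serves every \<open>s\<close>.\<close>

lemma calm_on_compose:
  fixes f :: "'p::real_normed_vector \<Rightarrow> 's \<Rightarrow> 'b::euclidean_space"
  assumes "lipschitz_on_bounded c" "calm_on S f p" "bounded (f p ` S)"
  shows "calm_on S (\<lambda>p s. c (f p s)) p"
proof -
  obtain B where B: "\<And>s. s \<in> S \<Longrightarrow> norm (f p s) \<le> B"
    using assms(3) by (auto simp: bounded_iff)
  obtain L where L: "L-lipschitz_on (cball 0 (B + 1)) c"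
    using assms(1) unfolding lipschitz_on_bounded_def by blast
  obtain C where C: "\<forall>\<^sub>F p' in nhds p. \<forall>s\<in>S. norm (f p' s - f p s) \<le> C * norm (p' - p)"
    using assms(2) unfolding calm_on_def by blast
  from C calm_on_eventually_close[OF assms(2) zero_less_one]
  have "\<forall>\<^sub>F p' in nhds p. \<forall>s\<in>S. norm (c (f p' s) - c (f p s)) \<le> (L * C) * norm (p' - p)"
  proof eventually_elim
    case (elim p')
    show ?case
    proof
      fix s assume s: "s \<in> S"
      have "norm (f p' s) \<le> norm (f p s) + norm (f p' s - f p s)"
        by norm
      then have "f p' s \<in> cball 0 (B + 1)" "f p s \<in> cball 0 (B + 1)"
        using B[OF s] elim(2) s by fastforce+
      then have "norm (c (f p' s) - c (f p s)) \<le> L * norm (f p' s - f p s)"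
        by (rule lipschitz_on_normD[OF L])
      also have "\<dots> \<le> L * (C * norm (p' - p))"
        using elim(1) s lipschitz_on_nonneg[OF L] by (intro mult_left_mono) auto
      finally show "norm (c (f p' s) - c (f p s)) \<le> (L * C) * norm (p' - p)"
        by simp
    qed
  qed
  then show ?thesis by (rule calm_onI)
qed

lemma calm_on_compose_compact:
  fixes f :: "'p::real_normed_vector \<Rightarrow> 's::topological_space \<Rightarrow> 'b::euclidean_space"
  assumes "lipschitz_on_bounded c" "calm_on S f p" "compact S" "continuous_on S (f p)"
  shows "calm_on S (\<lambda>p s. c (f p s)) p"
  using calm_on_compose[OF assms(1,2)] compact_imp_bounded[OF compact_continuous_image[OF assms(4,3)]]
  by simp

subsection \<open>Dependence on parameters over an interval without events\<close>

text \<open>Unlike the norm, its square is differentiable also where \<open>w\<close> vanishes.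
  Adding \<open>d\<^sup>2\<close> makes the differential inequality homogeneous, so multiplication
  by a decaying exponential gives a nonincreasing function.\<close>

lemma gronwall_norm_power2:
  fixes w w' :: "real \<Rightarrow> 'e::real_inner"
  assumes "0 \<le> \<tau>" and cont: "continuous_on {0..\<tau>} w"
    and deriv: "\<And>s. 0 < s \<Longrightarrow> s < \<tau> \<Longrightarrow> (w has_vector_derivative w' s) (at s)"
    and le: "\<And>s. 0 < s \<Longrightarrow> s < \<tau> \<Longrightarrow> norm (w' s) \<le> L * (d + norm (w s))"
    and "L \<ge> 0" "d \<ge> 0"
  shows "(norm (w \<tau>))\<^sup>2 + d\<^sup>2 \<le> ((norm (w 0))\<^sup>2 + d\<^sup>2) * exp (3 * L * \<tau>)"
proof -
  define f where "f s = (w s \<bullet> w s + d\<^sup>2) * exp (- (3 * L * s))" for s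
  have "f \<tau> \<le> f 0"
  proof (rule DERIV_nonpos_imp_decreasing_open[OF assms(1)])
    fix s assume s: "0 < s" "s < \<tau>"
    have dw: "(w has_derivative (\<lambda>h. h *\<^sub>R w' s)) (at s)"
      using deriv[OF s] unfolding has_vector_derivative_def .
    have "((\<lambda>s. w s \<bullet> w s) has_derivative (\<lambda>h. w s \<bullet> (h *\<^sub>R w' s) + (h *\<^sub>R w' s) \<bullet> w s)) (at s)"
      by (rule has_derivative_inner[OF dw dw])
    then have dww: "((\<lambda>s. w s \<bullet> w s) has_real_derivative 2 * (w s \<bullet> w' s)) (at s)"
      unfolding has_field_derivative_def
      by (rule has_derivative_eq_rhs) (auto simp: inner_commute algebra_simps)
    have "(f has_real_derivative (2 * (w s \<bullet> w' s) - 3 * L * (w s \<bullet> w s + d\<^sup>2)) * exp (- (3 * L * s))) (at s)"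
      unfolding f_def by (auto intro!: derivative_eq_intros dww simp: algebra_simps)
    moreover have "2 * (w s \<bullet> w' s) \<le> 3 * L * (w s \<bullet> w s + d\<^sup>2)"
    proof -
      have "w s \<bullet> w' s \<le> norm (w s) * norm (w' s)"
        by (rule norm_cauchy_schwarz)
      also have "\<dots> \<le> norm (w s) * (L * (d + norm (w s)))"
        using le[OF s] by (intro mult_left_mono) auto
      finally have "2 * (w s \<bullet> w' s) \<le> L * (2 * (norm (w s) * d) + 2 * (norm (w s))\<^sup>2)"
        by (simp add: algebra_simps power2_eq_square)
      also have "\<dots> \<le> L * (3 * ((norm (w s))\<^sup>2 + d\<^sup>2))"
      proof (rule mult_left_mono[OF _ \<open>L \<ge> 0\<close>])
        \<comment> \<open>This is exactly the difference of the two sides below, so the factor 3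
          suffices.\<close>
        have "0 \<le> (norm (w s) - d)\<^sup>2 + d\<^sup>2 + d\<^sup>2" by simp
        then show "2 * (norm (w s) * d) + 2 * (norm (w s))\<^sup>2 \<le> 3 * ((norm (w s))\<^sup>2 + d\<^sup>2)"
          by (simp add: power2_diff)
      qed
      finally show ?thesis
        by (simp add: power2_norm_eq_inner algebra_simps)
    qed
    ultimately show "\<exists>y. (f has_real_derivative y) (at s) \<and> y \<le> 0"
      by (meson diff_le_0_iff_le mult_nonpos_nonneg exp_ge_zero)
  next
    show "continuous_on {0..\<tau>} f"
      unfolding f_def by (intro continuous_intros cont)
  qed
  then show ?thesis
    unfolding f_def by (simp add: exp_minus power2_norm_eq_inner field_simps)
qed

text \<open>The Lipschitz constant of \<open>H\<close> is only available near the reference solution, hence the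
  argument runs up to the first time at which the perturbed solution leaves a unit tube.\<close>

lemma calm_on_solution:
  fixes H :: "'m::euclidean_space \<times> 'e::euclidean_space \<Rightarrow> 'e"
    and m :: "'p::real_normed_vector \<Rightarrow> real \<Rightarrow> 'm"
  assumes H: "lipschitz_on_bounded H"
    and m: "calm_on {0..1} m p" "bounded (m p ` {0..1})"
    and cont: "\<forall>\<^sub>F p' in nhds p. continuous_on {0..1} (U p')"
    and deriv: "\<forall>\<^sub>F p' in nhds p. \<forall>s. 0 < s \<longrightarrow> s < 1 \<longrightarrow>
      (U p' has_vector_derivative H (m p' s, U p' s)) (at s)"
    and init: "calm_on {0} U p"
  shows "calm_on {0..1} U p"
proof -
  have cont0: "continuous_on {0..1} (U p)"
    using eventually_nhds_x_imp_x[OF cont] .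
  have deriv0: "(U p has_vector_derivative H (m p s, U p s)) (at s)" if "0 < s" "s < 1" for s
    using eventually_nhds_x_imp_x[OF deriv] that by blast
  have "bounded (U p ` {0..1})"
    by (intro compact_imp_bounded compact_continuous_image cont0) auto
  then obtain B where B: "\<And>s. s \<in> {0..1} \<Longrightarrow> norm (U p s) \<le> B"
    by (simp only: bounded_iff ball_simps) blast
  obtain Bm where Bm: "\<And>s. s \<in> {0..1} \<Longrightarrow> norm (m p s) \<le> Bm"
    using m(2) by (simp only: bounded_iff ball_simps) blast
  \<comment> \<open>The margin 1 is the tube: \<open>m p'\<close> stays inside by calmness,
    \<open>U p'\<close> as long as its deviation is at most 1.\<close>
  define S :: "('m \<times> 'e) set" where "S = cball 0 (Bm + 1) \<times> cball 0 (B + 1)"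
  have "bounded S"
    unfolding S_def by (intro bounded_Times bounded_cball)
  then obtain L where L: "L-lipschitz_on S H"
    using H unfolding lipschitz_on_bounded_def by blast
  have L0: "L \<ge> 0"
    using lipschitz_on_nonneg[OF L] .
  obtain C where C: "C > 0" "\<forall>\<^sub>F p' in nhds p. \<forall>s\<in>{0..1}. norm (m p' s - m p s) \<le> C * norm (p' - p)"
    using calm_onE[OF m(1)] .
  obtain D where D: "D > 0" "\<forall>\<^sub>F p' in nhds p. \<forall>s\<in>{0}. norm (U p' s - U p s) \<le> D * norm (p' - p)"
    using calm_onE[OF init] .
  \<comment> \<open>\<open>C\<close> measures the perturbation of the data and \<open>D\<close> that
    of the initial value; \<open>exp (2 * L)\<close> is the square root of
    \<open>exp (4 * L)\<close>, to which the Gronwall factor is rounded up.\<close>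
  define K where "K = (C + D) * exp (2 * L)"
  have K: "K > 0"
    unfolding K_def using C(1) D(1) by simp
  \<comment> \<open>Makes \<open>K * d\<close> less than 1, so that the bound obtained inside the
    tube is strictly better than the tube radius it presupposes.\<close>
  have "\<forall>\<^sub>F p' in nhds p. norm (p' - p) < 1 / K"
    using K by (intro eventually_norm_diff_less) simp
  from this C(2) D(2) calm_on_eventually_close[OF m(1) zero_less_one] cont deriv
  have "\<forall>\<^sub>F p' in nhds p. \<forall>s\<in>{0..1}. norm (U p' s - U p s) \<le> K * norm (p' - p)"
  proof eventually_elim
    case (elim p')
    define d where "d = norm (p' - p)"
    define w where "w s = U p' s - U p s" for s
    have d: "d \<ge> 0" "K * d < 1"
      using elim(1) K unfolding d_def by (auto simp: field_simps)
    have contw: "continuous_on {0..1} w"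
      unfolding w_def by (intro continuous_intros elim(5) cont0)
    have tube: "norm (w \<tau>) \<le> K * d"
      if \<tau>: "\<tau> \<in> {0..1}" and w1: "\<And>s. 0 < s \<Longrightarrow> s < \<tau> \<Longrightarrow> norm (w s) \<le> 1" for \<tau>
    proof -
      have "(norm (w \<tau>))\<^sup>2 + (C * d)\<^sup>2 \<le> ((norm (w 0))\<^sup>2 + (C * d)\<^sup>2) * exp (3 * L * \<tau>)"
      proof (rule gronwall_norm_power2)
        show "0 \<le> \<tau>" "0 \<le> L" "0 \<le> C * d"
          using \<tau> L0 d C(1) by auto
        show "continuous_on {0..\<tau>} w"
          using \<tau> by (intro continuous_on_subset[OF contw]) auto
      next
        fix s assume s: "0 < s" "s < \<tau>"
        have s1: "s < 1" "s \<in> {0..1}" using s \<tau> by auto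
        show "(w has_vector_derivative H (m p' s, U p' s) - H (m p s, U p s)) (at s)"
          unfolding w_def using elim(6) deriv0 s(1) s1(1)
          by (intro has_vector_derivative_diff) auto
        have "norm (U p' s) \<le> norm (U p s) + norm (w s)" "norm (m p' s) \<le> norm (m p s) + norm (m p' s - m p s)"
          unfolding w_def by norm+
        moreover have "norm (m p' s - m p s) < 1"
          using elim(4) s1(2) by blast
        ultimately have "(m p' s, U p' s) \<in> S" "(m p s, U p s) \<in> S"
          using B[OF s1(2)] Bm[OF s1(2)] w1[OF s] unfolding S_def by auto
        then have "norm (H (m p' s, U p' s) - H (m p s, U p s)) \<le> L * norm (m p' s - m p s, w s)"
          using lipschitz_on_normD[OF L] unfolding w_def by fastforce
        also have "\<dots> \<le> L * (norm (m p' s - m p s) + norm (w s))"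
          by (intro mult_left_mono norm_Pair_le L0)
        also have "\<dots> \<le> L * (C * d + norm (w s))"
          using elim(2) s1(2) unfolding d_def by (intro mult_left_mono L0 add_mono) auto
        finally show "norm (H (m p' s, U p' s) - H (m p s, U p s)) \<le> L * (C * d + norm (w s))" .
      qed
      also have "\<dots> \<le> (((D * d)\<^sup>2 + (C * d)\<^sup>2)) * exp (4 * L)"
      proof (intro mult_mono add_mono power_mono order_refl)
        show "norm (w 0) \<le> D * d"
          using elim(3) unfolding w_def d_def by simp
        show "exp (3 * L * \<tau>) \<le> exp (4 * L)"
          using \<tau> L0 mult_left_mono[of \<tau> 1 L] by simp
      qed (use C(1) d(1) in auto)
      also have "\<dots> \<le> ((C + D)\<^sup>2 * d\<^sup>2) * exp (4 * L)"
        using C(1) D(1) by (intro mult_right_mono) (auto simp: power2_eq_square algebra_simps)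
      also have "\<dots> = (K * d)\<^sup>2"
        unfolding K_def power_mult_distrib exp_double[symmetric]
        by (simp add: power_mult_distrib exp_double[symmetric])
      finally have "(norm (w \<tau>))\<^sup>2 \<le> (K * d)\<^sup>2"
        using zero_le_power2[of "C * d"] by linarith
      moreover have "0 \<le> K * d"
        using K d(1) by simp
      ultimately show ?thesis
        by (rule power2_le_imp_le)
    qed
    \<comment> \<open>At a first time with deviation at least 1 the tube estimate still applies,
      since nothing earlier exceeded 1, and it forces the deviation below 1.\<close>
    have small: "norm (w s) < 1" if s: "s \<in> {0..1}" for s
    proof (rule ccontr)
      assume "\<not> norm (w s) < 1"
      define A where "A = {x \<in> {0..1}. 1 \<le> norm (w x)}"
      have "closed A"
        unfolding A_def by (intro continuous_on_closed_Collect_le continuous_intros contw)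
      then have "compact ({0..1} \<inter> A)"
        by (intro compact_Int_closed compact_Icc)
      moreover have "{0..1} \<inter> A = A"
        unfolding A_def by blast
      ultimately have "compact A"
        by simp
      moreover have "A \<noteq> {}"
        using \<open>\<not> norm (w s) < 1\<close> s unfolding A_def by auto
      ultimately obtain t where t: "t \<in> A" "\<And>x. x \<in> A \<Longrightarrow> t \<le> x"
        using compact_attains_inf[of A] by blast
      have "norm (w x) \<le> 1" if "0 < x" "x < t" for x
      proof (rule ccontr)
        assume "\<not> norm (w x) \<le> 1"
        then have "x \<in> A"
          using t(1) that unfolding A_def by simp
        then show False
          using t(2) that(2) by fastforce
      qed
      then have "norm (w t) \<le> K * d"
        using t(1) unfolding A_def by (intro tube) auto
      then show False
        using t(1) d(2) unfolding A_def by simp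
    qed
    have "norm (w s) \<le> K * d" if s: "s \<in> {0..1}" for s
    proof (rule tube[OF s])
      fix x assume "0 < x" "x < s"
      then have "x \<in> {0..1}" using s by simp
      from small[OF this] show "norm (w x) \<le> 1" by simp
    qed
    then show ?case
      unfolding w_def d_def by blast
  qed
  then show ?thesis by (rule calm_onI)
qed

subsection \<open>Integrals up to a moving endpoint\<close>

text \<open>The endpoints carry no order because in the application \<open>s\<close> may lie on
  either side of \<open>s0\<close>, and the perturbed point \<open>s'\<close> on either side of
  \<open>s\<close>.\<close>

lemma mvt_bound_between:
  fixes f :: "real \<Rightarrow> real"
  assumes cont: "continuous_on {min x y..max x y} f"
    and deriv: "\<And>s. min x y < s \<Longrightarrow> s < max x y \<Longrightarrow> (f has_real_derivative f' s) (at s)"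
    and le: "\<And>s. min x y < s \<Longrightarrow> s < max x y \<Longrightarrow> \<bar>f' s\<bar> \<le> B"
  shows "\<bar>f x - f y\<bar> \<le> B * \<bar>x - y\<bar>"
proof -
  have *: "\<bar>f b - f a\<bar> \<le> B * (b - a)"
    if le: "a \<le> b" and c: "continuous_on {a..b} f"
      and d: "\<And>s. a < s \<Longrightarrow> s < b \<Longrightarrow> (f has_real_derivative f' s) (at s) \<and> \<bar>f' s\<bar> \<le> B" for a b
  proof (cases "a = b")
    case False
    then have "a < b" using le by simp
    moreover have "f differentiable at x" if "a < x" "x < b" for x
      using d[OF that] real_differentiable_def by blast
    ultimately obtain l z where z: "a < z" "z < b" "(f has_real_derivative l) (at z)" "f b - f a = (b - a) * l"
      using MVT[of a b f] c by blast
    then have "l = f' z"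
      using d DERIV_unique by blast
    then have "\<bar>l\<bar> \<le> B"
      using d z by blast
    then show ?thesis
      unfolding z(4) abs_mult using \<open>a < b\<close> by (simp add: mult.commute mult_left_mono)
  qed simp
  show ?thesis
  proof (cases "x \<le> y")
    case True
    then show ?thesis
      using *[of x y] assms by (simp add: abs_minus_commute min_def max_def)
  next
    case False
    then show ?thesis
      using *[of y x] assms by (simp add: min_def max_def)
  qed
qed

text \<open>\<open>W q s\<close> stands for the integral of the running cost up to the time \<open>\<phi> q s\<close>; the
  point \<open>s'\<close> belongs, for the parameter \<open>q\<close>, to the time that \<open>s\<close> belongs to for \<open>p\<close>.
  Subtracting from \<open>W\<close> the function with constant integrand \<open>k p s0\<close> makes the remaining
  integrands small near \<open>s0\<close>.\<close>

lemma moving_endpoint_estimate: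
  fixes W k :: "'p::real_normed_vector \<Rightarrow> real \<Rightarrow> real" and a l :: "'p \<Rightarrow> real"
  assumes \<phi>_def: "\<And>q s. \<phi> q s = a q + s * l q"
    and k: "calm_on {0..1} k p" "continuous_on {0..1} (k p)"
    and calm: "calm_on {0..1} \<phi> p" "calm_on {0..1::real} (\<lambda>q s. l q) p" and l: "l p > 0"
    and cont: "\<forall>\<^sub>F q in nhds p. continuous_on {0..1} (W q)"
    and deriv: "\<forall>\<^sub>F q in nhds p. \<forall>s. 0 < s \<longrightarrow> s < 1 \<longrightarrow> (W q has_real_derivative l q * k q s) (at s)"
    and s0: "s0 \<in> {0..1}" and "\<eta> > 0"
  shows "\<forall>\<^sub>F s in at s0 within {0<..<1}. \<forall>\<^sub>F q in nhds p. \<forall>s'. \<phi> q s' = \<phi> p s \<longrightarrow>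
    \<bar>(W q s0 - W q s') - (W p s0 - W p s) - (\<phi> q s0 - \<phi> p s0) * k p s0\<bar> \<le> \<eta> * norm (q - p)"
proof -
  \<comment> \<open>\<open>m q\<close> is the derivative of \<open>V q\<close> below, as
    \<open>\<phi> q\<close> has slope \<open>l q\<close>.\<close>
  define m where "m q s = l q * (k q s - k p s0)" for q s
  define V where "V q s = W q s - \<phi> q s * k p s0" for q s
  have "lipschitz_on_bounded (\<lambda>x::real \<times> real. fst x * (snd x + (- k p s0)))"
    by (intro lipschitz_on_bounded_bilinear_compose[OF bounded_bilinear_mult] lipschitz_on_bounded_add
        lipschitz_on_bounded_fst lipschitz_on_bounded_snd lipschitz_on_bounded_const)
  from calm_on_compose_compact[OF this calm_on_Pair[OF calm(2) k(1)]]
  have "calm_on {0..1} m p"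
    unfolding m_def by (simp add: k(2) continuous_on_Pair)
  then obtain C where C: "C > 0" "\<forall>\<^sub>F q in nhds p. \<forall>s\<in>{0..1}. norm (m q s - m p s) \<le> C * norm (q - p)"
    by (rule calm_onE)
  obtain D where D: "D > 0" "\<forall>\<^sub>F q in nhds p. \<forall>s\<in>{0..1}. norm (\<phi> q s - \<phi> p s) \<le> D * norm (q - p)"
    using calm_onE[OF calm(1)] .
  \<comment> \<open>Half of \<open>\<eta>\<close> is spent between \<open>s\<close> and
    \<open>s0\<close>, half between \<open>s'\<close> and \<open>s\<close>; \<open>D\<close>
    converts the time shift of the latter into \<open>norm (q - p)\<close>.\<close>
  define \<eta>2 where "\<eta>2 = \<eta> / (2 * D)"
  have \<eta>2: "\<eta>2 > 0" using \<open>\<eta> > 0\<close> D(1) unfolding \<eta>2_def by simp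
  obtain d where d: "d > 0" "\<And>s. s \<in> {0..1} \<Longrightarrow> \<bar>s - s0\<bar> < d \<Longrightarrow> \<bar>k p s - k p s0\<bar> < \<eta>2 / 2"
    using k(2) s0 \<eta>2 unfolding continuous_on_iff dist_real_def by (meson half_gt_zero)
  have l2: "\<forall>\<^sub>F q in nhds p. l q > l p / 2"
    using calm_on_eventually_close[OF calm(2) half_gt_zero[OF l]]
  proof eventually_elim
    case (elim q)
    then have "norm (l q - l p) < l p / 2" using s0 by blast
    then show ?case unfolding real_norm_def by linarith
  qed
  \<comment> \<open>\<open>d / 2\<close> leaves room to move on from \<open>s\<close> to
    \<open>s'\<close>; \<open>\<eta> / (2 * C)\<close> keeps the error between \<open>s\<close> and
    \<open>s0\<close> within its half.\<close>
  have "\<forall>\<^sub>F s in at s0 within {0<..<1}. s \<in> {0<..<1} \<and> \<bar>s - s0\<bar> < min (d / 2) (\<eta> / (2 * C))"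
    using d(1) \<open>\<eta> > 0\<close> C(1) unfolding eventually_at dist_real_def
    by (intro exI[of _ "min (d / 2) (\<eta> / (2 * C))"]) auto
  then show ?thesis
  proof eventually_elim
    case (elim s)
    then have s: "0 < s" "s < 1" "s \<in> {0..1}" "\<bar>s - s0\<bar> < d / 2" "\<bar>s - s0\<bar> < \<eta> / (2 * C)"
      by auto
    \<comment> \<open>Points closer than \<open>r\<close> to \<open>s\<close> stay in the open unit
      interval and within \<open>d\<close> of \<open>s0\<close>.\<close>
    define r where "r = min (d / 2) (min s (1 - s))"
    have r: "r > 0" "r \<le> d / 2" "r \<le> s" "r \<le> 1 - s"
      unfolding r_def using d(1) s(1,2) by (simp_all only: min_def) (simp_all split: if_splits)
    \<comment> \<open>Division by \<open>l q > l p / 2\<close> turns this shift in time into a shift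
      below \<open>r\<close> in the rescaled variable.\<close>
    have "\<forall>\<^sub>F q in nhds p. \<forall>s\<in>{0..1}. norm (\<phi> q s - \<phi> p s) < r * (l p / 2)"
      using r(1) l by (intro calm_on_eventually_close[OF calm(1)]) simp
    moreover have "\<forall>\<^sub>F q in nhds p. \<forall>s\<in>{0..1}. norm (k q s - k p s) < \<eta>2 / 2"
      using \<eta>2 by (intro calm_on_eventually_close[OF k(1)]) simp
    ultimately show ?case
      using C(2) D(2) l2 cont deriv
    proof eventually_elim
      case (elim q)
      show ?case
      proof (intro allI impI)
        fix s' assume s': "\<phi> q s' = \<phi> p s"
        have lq: "l q > 0" using elim(5) l by simp
        have shift: "\<phi> q s - \<phi> p s = (s - s') * l q"
          unfolding s'[symmetric] by (simp add: \<phi>_def algebra_simps)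
        have "\<bar>s - s'\<bar> * l q < r * (l p / 2)"
          using elim(1) s(3) shift lq by (fastforce simp: abs_mult)
        also have "\<dots> \<le> r * l q"
          using elim(5) r(1) by (intro mult_left_mono) auto
        finally have close: "\<bar>s - s'\<bar> < r"
          using lq by simp
        have Vderiv: "(V q has_real_derivative m q x) (at x)" if "0 < x" "x < 1" for x
        proof -
          have "(W q has_real_derivative l q * k q x) (at x)"
            using elim(7) that by blast
          then show ?thesis
            unfolding V_def m_def \<phi>_def
            by (auto intro!: derivative_eq_intros simp: algebra_simps)
        qed
        have Vcont: "continuous_on {0..1} (V q)"
          unfolding V_def \<phi>_def by (intro continuous_intros elim(6))
        have Vpderiv: "(V p has_real_derivative m p x) (at x)" if "0 < x" "x < 1" for x
        proof -
          have "(W p has_real_derivative l p * k p x) (at x)"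
            using eventually_nhds_x_imp_x[OF deriv] that by blast
          then show ?thesis
            unfolding V_def m_def \<phi>_def
            by (auto intro!: derivative_eq_intros simp: algebra_simps)
        qed
        have Vpcont: "continuous_on {0..1} (V p)"
          unfolding V_def \<phi>_def by (intro continuous_intros eventually_nhds_x_imp_x[OF cont])
        \<comment> \<open>Two parameters at equal rescaled times: calmness of \<open>m\<close>
          bounds the difference of the slopes.\<close>
        have "\<bar>(V q s0 - V p s0) - (V q s - V p s)\<bar> \<le> (C * norm (q - p)) * \<bar>s0 - s\<bar>"
        proof (rule mvt_bound_between[where f' = "\<lambda>x. m q x - m p x"])
          show "continuous_on {min s0 s..max s0 s} (\<lambda>x. V q x - V p x)"
            using s0 s(3)
            by (intro continuous_on_subset[OF continuous_on_diff[OF Vcont Vpcont]]) auto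
        next
          fix x assume "min s0 s < x" "x < max s0 s"
          then have x: "0 < x" "x < 1"
            using s0 s(3) by auto
          show "((\<lambda>x. V q x - V p x) has_real_derivative m q x - m p x) (at x)"
            by (intro derivative_intros Vderiv Vpderiv x)
          show "\<bar>m q x - m p x\<bar> \<le> C * norm (q - p)"
            using elim(3) x by simp
        qed
        also have "\<dots> = (C * \<bar>s - s0\<bar>) * norm (q - p)"
          by (simp add: abs_minus_commute)
        also have "\<dots> \<le> (\<eta> / 2) * norm (q - p)"
          using s(5) C(1) by (intro mult_right_mono) (auto simp: field_simps)
        finally have 1: "\<bar>(V q s0 - V p s0) - (V q s - V p s)\<bar> \<le> (\<eta> / 2) * norm (q - p)" .
        \<comment> \<open>One parameter at two close points: here the slope itself is small, because
          \<open>k q\<close> is near \<open>k p s0\<close>.\<close>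
        have "\<bar>V q s - V q s'\<bar> \<le> (l q * \<eta>2) * \<bar>s - s'\<bar>"
        proof (rule mvt_bound_between[where f' = "m q"])
          show "continuous_on {min s s'..max s s'} (V q)"
            using close r s(1,2)
            by (intro continuous_on_subset[OF Vcont]) (auto simp: min_def max_def split: if_splits)
        next
          fix x assume x: "min s s' < x" "x < max s s'"
          then have "\<bar>x - s\<bar> < r"
            using close by (auto simp: min_def max_def split: if_splits)
          then have x': "0 < x" "x < 1" "\<bar>x - s0\<bar> < d"
            using r s by linarith+
          then show "(V q has_real_derivative m q x) (at x)"
            by (intro Vderiv)
          have "\<bar>k q x - k p x\<bar> < \<eta>2 / 2" "\<bar>k p x - k p s0\<bar> < \<eta>2 / 2"
            using elim(2) d(2)[of x] x' by auto
          then have "\<bar>k q x - k p s0\<bar> \<le> \<eta>2"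
            by linarith
          then show "\<bar>m q x\<bar> \<le> l q * \<eta>2"
            unfolding m_def abs_mult using lq by simp
        qed
        also have "\<dots> = \<eta>2 * \<bar>\<phi> q s - \<phi> p s\<bar>"
          unfolding shift using lq by (simp add: abs_mult)
        also have "\<dots> \<le> \<eta>2 * (D * norm (q - p))"
          using elim(4) s(3) \<eta>2 by (intro mult_left_mono) auto
        also have "\<dots> = (\<eta> / 2) * norm (q - p)"
          using D(1) unfolding \<eta>2_def by simp
        finally have 2: "\<bar>V q s - V q s'\<bar> \<le> (\<eta> / 2) * norm (q - p)" .
        have "(W q s0 - W q s') - (W p s0 - W p s) - (\<phi> q s0 - \<phi> p s0) * k p s0
          = ((V q s0 - V p s0) - (V q s - V p s)) + (V q s - V q s')"
          unfolding V_def s' by (simp add: algebra_simps)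
        with 1 2 show "\<bar>(W q s0 - W q s') - (W p s0 - W p s) - (\<phi> q s0 - \<phi> p s0) * k p s0\<bar>
          \<le> \<eta> * norm (q - p)"
          by linarith
      qed
    qed
  qed
qed

text \<open>Row vectors are encoded as gradients. This form, on full neighbourhoods and free of
  division, combines directly with calmness estimates.\<close>

lemma GDERIV_iff_eventually:
  "GDERIV f p :> D \<longleftrightarrow>
    (\<forall>e>0. \<forall>\<^sub>F q in nhds p. \<bar>f q - f p - (q - p) \<bullet> D\<bar> \<le> e * norm (q - p))"
  unfolding gderiv_def has_derivative_at_alt eventually_nhds_metric dist_norm
  by (simp add: bounded_linear_inner_left)

text \<open>The increment is split at the fixed time \<open>\<phi> p s\<close>: the part before it
  has gradient \<open>Z s\<close>, the rest contributes the rate times the displacement of the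
  endpoint. For each error a single \<open>s\<close> is chosen first and the neighbourhood of
  \<open>p\<close> afterwards, so the fixed-time gradients need no uniformity as \<open>s\<close>
  tends to \<open>s0\<close>.\<close>

lemma gderiv_moving_endpoint:
  fixes z :: "'p::real_inner \<Rightarrow> real \<Rightarrow> real" and k :: "'p \<Rightarrow> real \<Rightarrow> real" and a l :: "'p \<Rightarrow> real"
  assumes \<phi>_def: "\<And>q s. \<phi> q s = a q + s * l q"
    and k: "calm_on {0..1} k p" "continuous_on {0..1} (k p)"
    and calm: "calm_on {0..1} \<phi> p" "calm_on {0..1::real} (\<lambda>q s. l q) p" and l: "l p > 0"
    and cont: "\<forall>\<^sub>F q in nhds p. continuous_on {0..1} (\<lambda>s. z q (\<phi> q s))"
    and deriv: "\<forall>\<^sub>F q in nhds p. \<forall>s. 0 < s \<longrightarrow> s < 1 \<longrightarrow>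
      ((\<lambda>s. z q (\<phi> q s)) has_real_derivative l q * k q s) (at s)"
    and s0: "s0 \<in> {0..1}"
    and endpoint: "GDERIV (\<lambda>q. \<phi> q s0) p :> T"
    and fixed: "\<forall>\<^sub>F s in at s0 within {0<..<1}. GDERIV (\<lambda>q. z q (\<phi> p s)) p :> Z s"
    and lim: "(Z \<longlongrightarrow> Z0) (at s0 within {0<..<1})"
  shows "GDERIV (\<lambda>q. z q (\<phi> q s0)) p :> Z0 + k p s0 *\<^sub>R T"
  unfolding GDERIV_iff_eventually
proof (intro allI impI)
  fix e :: real assume "e > 0"
  \<comment> \<open>Four errors add up: the moving-endpoint estimate, the fixed-time linearization
    and the distance from \<open>Z s\<close> to \<open>Z0\<close> cost \<open>\<eta>\<close> each,
    the linearized endpoint costs \<open>\<bar>k p s0\<bar>\<close> times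
    \<open>\<eta>\<close>.\<close>
  define \<eta> where "\<eta> = e / (3 + \<bar>k p s0\<bar>)"
  have "3 + \<bar>k p s0\<bar> > 0"
    by simp
  then have \<eta>: "\<eta> > 0" "(3 + \<bar>k p s0\<bar>) * \<eta> = e"
    using \<open>e > 0\<close> unfolding \<eta>_def by (simp, metis nonzero_mult_div_cancel_left less_irrefl times_divide_eq_right)
  \<comment> \<open>Even if \<open>s0\<close> is 0 or 1 it is a limit point of the open interval, so
    the eventual properties are met by some \<open>s\<close>.\<close>
  have "{0..1::real} \<noteq> {x}" for x
    using atLeastAtMost_singleton_iff[of 0 1 x] by simp
  then have "s0 islimpt {0..1}"
    by (rule connected_imp_perfect[OF connected_Icc s0])
  then have "s0 islimpt {0<..<1}"
    by (metis closure_greaterThanLessThan limpt_of_closure zero_less_one)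
  then have "at s0 within {0<..<1::real} \<noteq> bot"
    by (simp add: trivial_limit_within)
  moreover have "\<forall>\<^sub>F s in at s0 within {0<..<1}. dist (Z s) Z0 < \<eta>"
    using lim \<eta>(1) by (rule tendstoD)
  with fixed moving_endpoint_estimate[OF \<phi>_def k calm l cont deriv s0 \<eta>(1)]
  have "\<forall>\<^sub>F s in at s0 within {0<..<1}. GDERIV (\<lambda>q. z q (\<phi> p s)) p :> Z s \<and> norm (Z s - Z0) < \<eta> \<and>
    (\<forall>\<^sub>F q in nhds p. \<forall>s'. \<phi> q s' = \<phi> p s \<longrightarrow>
      \<bar>(z q (\<phi> q s0) - z q (\<phi> q s')) - (z p (\<phi> p s0) - z p (\<phi> p s)) - (\<phi> q s0 - \<phi> p s0) * k p s0\<bar>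
        \<le> \<eta> * norm (q - p))"
    unfolding dist_norm by eventually_elim blast
  ultimately obtain s where s: "GDERIV (\<lambda>q. z q (\<phi> p s)) p :> Z s" "norm (Z s - Z0) < \<eta>"
    and est: "\<forall>\<^sub>F q in nhds p. \<forall>s'. \<phi> q s' = \<phi> p s \<longrightarrow>
      \<bar>(z q (\<phi> q s0) - z q (\<phi> q s')) - (z p (\<phi> p s0) - z p (\<phi> p s)) - (\<phi> q s0 - \<phi> p s0) * k p s0\<bar>
        \<le> \<eta> * norm (q - p)"
    using eventually_happens by blast
  have "\<forall>\<^sub>F q in nhds p. \<bar>z q (\<phi> p s) - z p (\<phi> p s) - (q - p) \<bullet> Z s\<bar> \<le> \<eta> * norm (q - p)"
    using s(1) \<eta>(1) unfolding GDERIV_iff_eventually by blast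
  moreover have "\<forall>\<^sub>F q in nhds p. \<bar>\<phi> q s0 - \<phi> p s0 - (q - p) \<bullet> T\<bar> \<le> \<eta> * norm (q - p)"
    using endpoint \<eta>(1) unfolding GDERIV_iff_eventually by blast
  moreover have "\<forall>\<^sub>F q in nhds p. l q > 0"
    using calm_on_eventually_close[OF calm(2) l]
  proof eventually_elim
    case (elim q)
    then have "norm (l q - l p) < l p" using s0 by blast
    then show ?case unfolding real_norm_def by linarith
  qed
  ultimately show "\<forall>\<^sub>F q in nhds p. \<bar>z q (\<phi> q s0) - z p (\<phi> p s0) - (q - p) \<bullet> (Z0 + k p s0 *\<^sub>R T)\<bar>
      \<le> e * norm (q - p)"
    using est
  proof eventually_elim
    case (elim q)
    define s' where "s' = (\<phi> p s - a q) / l q"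
    have s': "\<phi> q s' = \<phi> p s"
      using elim(3) unfolding s'_def \<phi>_def by simp
    have 1: "\<bar>(z q (\<phi> q s0) - z q (\<phi> p s)) - (z p (\<phi> p s0) - z p (\<phi> p s)) - (\<phi> q s0 - \<phi> p s0) * k p s0\<bar>
        \<le> \<eta> * norm (q - p)"
      using elim(4) s' by metis
    have 2: "\<bar>(q - p) \<bullet> (Z s - Z0)\<bar> \<le> \<eta> * norm (q - p)"
      using Cauchy_Schwarz_ineq2[of "q - p" "Z s - Z0"] mult_right_mono[OF less_imp_le[OF s(2)], of "norm (q - p)"]
      by (simp add: mult.commute)
    have 3: "\<bar>(\<phi> q s0 - \<phi> p s0 - (q - p) \<bullet> T) * k p s0\<bar> \<le> \<bar>k p s0\<bar> * \<eta> * norm (q - p)"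
      using mult_right_mono[OF elim(2), of "\<bar>k p s0\<bar>"] by (simp add: abs_mult mult_ac)
    have "z q (\<phi> q s0) - z p (\<phi> p s0) - (q - p) \<bullet> (Z0 + k p s0 *\<^sub>R T)
      = ((z q (\<phi> q s0) - z q (\<phi> p s)) - (z p (\<phi> p s0) - z p (\<phi> p s)) - (\<phi> q s0 - \<phi> p s0) * k p s0)
        + (z q (\<phi> p s) - z p (\<phi> p s) - (q - p) \<bullet> Z s)
        + (q - p) \<bullet> (Z s - Z0) + (\<phi> q s0 - \<phi> p s0 - (q - p) \<bullet> T) * k p s0"
      by (simp add: inner_diff_right inner_add_right algebra_simps)
    moreover have "e * norm (q - p) = \<eta> * norm (q - p) + \<eta> * norm (q - p) + \<eta> * norm (q - p)
        + \<bar>k p s0\<bar> * \<eta> * norm (q - p)"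
      unfolding \<eta>(2)[symmetric] by (simp add: algebra_simps)
    ultimately show ?case
      using 1 2 3 elim(1) by linarith
  qed
qed

subsection \<open>Families of trajectories with jumps\<close>

text \<open>Event \<open>j\<close> is preceded by segment \<open>j\<close> and followed by segment \<open>Suc j\<close>; segment \<open>j\<close> lasts
  from \<open>e j\<close> to \<open>e (Suc j)\<close>, so that \<open>e 0\<close> and \<open>e (Suc N)\<close> are the initial and the final time.\<close>

locale piecewise_flow =
  fixes N :: nat and P :: "'p::euclidean_space set"
    and e :: "nat \<Rightarrow> 'p \<Rightarrow> real"
    and y :: "'p \<Rightarrow> real \<Rightarrow> 'e::euclidean_space"
    and start stop :: "nat \<Rightarrow> 'p \<Rightarrow> 'e"
    and G :: "real \<times> 'e \<times> 'p \<Rightarrow> 'e"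
    and J :: "nat \<Rightarrow> real \<times> 'e \<times> 'p \<Rightarrow> 'e"
  assumes open_P: "open P"
    and order: "\<And>j p. j \<le> N \<Longrightarrow> p \<in> P \<Longrightarrow> e j p < e (Suc j) p"
    and ode: "\<And>j p t. j \<le> N \<Longrightarrow> p \<in> P \<Longrightarrow> e j p < t \<Longrightarrow> t < e (Suc j) p \<Longrightarrow>
      (y p has_vector_derivative G (t, y p t, p)) (at t)"
    and start: "\<And>j p. j \<le> N \<Longrightarrow> p \<in> P \<Longrightarrow> (y p \<longlongrightarrow> start j p) (at_right (e j p))"
    and stop: "\<And>j p. j \<le> N \<Longrightarrow> p \<in> P \<Longrightarrow> (y p \<longlongrightarrow> stop j p) (at_left (e (Suc j) p))"
    and jump: "\<And>j p. j < N \<Longrightarrow> p \<in> P \<Longrightarrow> start (Suc j) p = J j (e (Suc j) p, stop j p, p)"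
    and G_lipschitz: "lipschitz_on_bounded G"
    and J_lipschitz: "\<And>j. j < N \<Longrightarrow> lipschitz_on_bounded (J j)"
    and event_time_calm: "\<And>j p S. j \<le> Suc N \<Longrightarrow> p \<in> P \<Longrightarrow> calm_on (S::real set) (\<lambda>p s. e j p) p"
    and initial_calm: "\<And>p. p \<in> P \<Longrightarrow> calm_on {0::real} (\<lambda>p s. start 0 p) p"
begin

definition len :: "nat \<Rightarrow> 'p \<Rightarrow> real" where
  "len j p = e (Suc j) p - e j p"

definition time :: "nat \<Rightarrow> 'p \<Rightarrow> real \<Rightarrow> real" where
  "time j p s = e j p + s * len j p"

text \<open>The value of \<open>y p\<close> at an event time is unconstrained; inserting the
  one-sided limits makes each piece continuous on a closed interval.\<close>

definition closed_seg :: "nat \<Rightarrow> 'p \<Rightarrow> real \<Rightarrow> 'e" where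
  "closed_seg j p t = (if t \<le> e j p then start j p else if t \<ge> e (Suc j) p then stop j p else y p t)"

definition state :: "nat \<Rightarrow> 'p \<Rightarrow> real \<Rightarrow> 'e" where
  "state j p s = closed_seg j p (time j p s)"

lemma len_pos: "j \<le> N \<Longrightarrow> p \<in> P \<Longrightarrow> len j p > 0"
  using order unfolding len_def by simp

lemma time_ends [simp]: "time j p 0 = e j p" "time j p 1 = e (Suc j) p"
  unfolding time_def len_def by auto

lemma time_strict_mono: "j \<le> N \<Longrightarrow> p \<in> P \<Longrightarrow> s < s' \<Longrightarrow> time j p s < time j p s'"
  using len_pos unfolding time_def by simp

lemma time_inside:
  assumes "j \<le> N" "p \<in> P" "0 < s" "s < 1"
  shows "e j p < time j p s" "time j p s < e (Suc j) p"
  using time_strict_mono[OF assms(1,2)] assms(3,4) time_ends by metis+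

lemma time_closed:
  assumes "j \<le> N" "p \<in> P" "s \<in> {0..1}"
  shows "time j p s \<in> {e j p..e (Suc j) p}"
  using time_inside[OF assms(1,2), of s] assms order[OF assms(1,2)]
  by (cases "s = 0 \<or> s = 1") auto

lemma state_ends [simp]:
  assumes "j \<le> N" "p \<in> P"
  shows "state j p 0 = start j p" "state j p 1 = stop j p"
  using order[OF assms] unfolding state_def closed_seg_def by auto

lemma continuous_on_closed_seg:
  assumes "j \<le> N" "p \<in> P"
  shows "continuous_on {e j p..e (Suc j) p} (closed_seg j p)"
proof (rule continuous_on_IccI[OF _ _ _ order[OF assms]])
  note less = order[OF assms]
  have near: "\<forall>\<^sub>F t in F. closed_seg j p t = y p t"
    if "\<forall>\<^sub>F t in F. e j p < t \<and> t < e (Suc j) p" for F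
    using that by eventually_elim (auto simp: closed_seg_def)
  have "(closed_seg j p \<longlongrightarrow> start j p) (at_right (e j p))"
    using start[OF assms] less
    by (subst tendsto_cong[OF near]) (auto simp: eventually_at_right_field)
  then show "(closed_seg j p \<longlongrightarrow> closed_seg j p (e j p)) (at_right (e j p))"
    by (simp add: closed_seg_def)
  have "(closed_seg j p \<longlongrightarrow> stop j p) (at_left (e (Suc j) p))"
    using stop[OF assms] less
    by (subst tendsto_cong[OF near]) (auto simp: eventually_at_left_field)
  then show "(closed_seg j p \<longlongrightarrow> closed_seg j p (e (Suc j) p)) (at_left (e (Suc j) p))"
    using less by (simp add: closed_seg_def)
  fix t assume t: "e j p < t" "t < e (Suc j) p"
  have "\<forall>\<^sub>F x in at t. x \<in> {e j p<..<e (Suc j) p}"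
    using t by (intro eventually_at_in_open') auto
  then have "(closed_seg j p \<longlongrightarrow> y p t) (at t) \<longleftrightarrow> (y p \<longlongrightarrow> y p t) (at t)"
    by (intro tendsto_cong near) simp
  moreover have "isCont (y p) t"
    using ode[OF assms t] has_vector_derivative_continuous by blast
  ultimately show "(closed_seg j p \<longlongrightarrow> closed_seg j p t) (at t)"
    using t by (simp add: closed_seg_def isCont_def)
qed

lemma continuous_on_state:
  assumes "j \<le> N" "p \<in> P"
  shows "continuous_on {0..1} (state j p)"
proof -
  have "continuous_on {0..1} (time j p)"
    unfolding time_def by (intro continuous_intros)
  moreover have "time j p ` {0..1} \<subseteq> {e j p..e (Suc j) p}"
    using time_closed[OF assms] by blast
  ultimately show ?thesis
    unfolding state_def
    by (rule continuous_on_compose2[OF continuous_on_closed_seg[OF assms]])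
qed

lemma state_deriv:
  assumes "j \<le> N" "p \<in> P" "0 < s" "s < 1"
  shows "(state j p has_vector_derivative len j p *\<^sub>R G (time j p s, state j p s, p)) (at s)"
proof -
  have y: "state j p x = y p (time j p x)" if "0 < x" "x < 1" for x
    using time_inside[OF assms(1,2) that] unfolding state_def closed_seg_def by simp
  have "(time j p has_real_derivative len j p) (at s)"
    unfolding time_def by (auto intro!: derivative_eq_intros)
  then have "(y p \<circ> time j p has_vector_derivative len j p *\<^sub>R G (time j p s, y p (time j p s), p)) (at s)"
    by (intro vector_diff_chain_at ode[OF assms(1,2)] time_inside[OF assms])
      (simp add: has_real_derivative_iff_has_vector_derivative)
  moreover have "\<And>x. x \<in> {0<..<1} \<Longrightarrow> (y p \<circ> time j p) x = state j p x"
    using y by simp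
  ultimately have "(state j p has_vector_derivative len j p *\<^sub>R G (time j p s, y p (time j p s), p)) (at s)"
    using has_vector_derivative_transform_within_open[of "y p \<circ> time j p" _ s "{0<..<1}"] assms(3,4)
    by simp
  then show ?thesis
    using y[OF assms(3,4)] by simp
qed

lemma calm_len: "j \<le> N \<Longrightarrow> p \<in> P \<Longrightarrow> calm_on {0..1::real} (\<lambda>p s. len j p) p"
proof -
  assume j: "j \<le> N" "p \<in> P"
  have "lipschitz_on_bounded (\<lambda>x::real \<times> real. fst x - snd x)"
    by (intro lipschitz_on_bounded_linear bounded_linear_sub bounded_linear_fst bounded_linear_snd)
  from calm_on_compose_compact[OF this calm_on_Pair[OF event_time_calm event_time_calm], of "Suc j" p j]
  show ?thesis
    unfolding len_def using j by simp
qed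

lemma calm_time: "j \<le> N \<Longrightarrow> p \<in> P \<Longrightarrow> calm_on {0..1} (time j) p"
proof -
  assume j: "j \<le> N" "p \<in> P"
  have "lipschitz_on_bounded (\<lambda>x::real \<times> real \<times> real. fst x + fst (snd x) * snd (snd x))"
    by (intro lipschitz_on_bounded_add lipschitz_on_bounded_bilinear_compose[OF bounded_bilinear_mult]
        lipschitz_on_bounded_linear bounded_linear_fst bounded_linear_snd
        bounded_linear_compose[OF bounded_linear_fst] bounded_linear_compose[OF bounded_linear_snd])
  from calm_on_compose_compact[OF this
      calm_on_Pair[OF event_time_calm[of j] calm_on_Pair[OF calm_on_const[of _ "\<lambda>s. s"] calm_len[OF j]]]]
  show ?thesis
    unfolding time_def using j by (simp add: continuous_intros)
qed

lemma eventually_in_P: "p \<in> P \<Longrightarrow> \<forall>\<^sub>F q in nhds p. q \<in> P"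
  using open_P eventually_nhds_in_open by blast

text \<open>After rescaling, the parameter acts through \<open>len\<close>, \<open>time\<close> and
  itself; this triple is the datum \<open>m\<close> of \<open>calm_on_solution\<close>, and the
  leading factor in \<open>H\<close> comes from the chain rule.\<close>

lemma calm_state_step:
  assumes "j \<le> N" "p \<in> P" and start: "calm_on {0::real} (\<lambda>p s. start j p) p"
  shows "calm_on {0..1} (state j) p"
proof -
  define H where "H x = fst (fst x) *\<^sub>R G (fst (snd (fst x)), snd x, snd (snd (fst x)))"
    for x :: "(real \<times> real \<times> 'p) \<times> 'e"
  show ?thesis
  proof (rule calm_on_solution[where H = H])
    show "lipschitz_on_bounded H"
      unfolding H_def by (intro lipschitz_on_bounded_bilinear_compose[OF bounded_bilinear_scaleR]
          lipschitz_on_bounded_compose[OF G_lipschitz] lipschitz_on_bounded_linear bounded_linear_Pair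
          bounded_linear_fst bounded_linear_snd
          bounded_linear_compose[OF bounded_linear_fst] bounded_linear_compose[OF bounded_linear_snd])
    show "calm_on {0..1} (\<lambda>q s. (len j q, time j q s, q)) p"
      by (intro calm_on_Pair calm_len calm_time calm_on_ident assms)
    have "continuous_on {0..1} (\<lambda>s. (len j p, time j p s, p))"
      unfolding time_def by (intro continuous_intros)
    then show "bounded ((\<lambda>s. (len j p, time j p s, p)) ` {0..1})"
      by (intro compact_imp_bounded compact_continuous_image compact_Icc)
    show "\<forall>\<^sub>F q in nhds p. continuous_on {0..1} (state j q)"
      using eventually_in_P[OF assms(2)] by eventually_elim (rule continuous_on_state[OF assms(1)])
    show "\<forall>\<^sub>F q in nhds p. \<forall>s. 0 < s \<longrightarrow> s < 1 \<longrightarrow> (state j q has_vector_derivative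
        H ((len j q, time j q s, q), state j q s)) (at s)"
      using eventually_in_P[OF assms(2)] by eventually_elim (simp add: H_def state_deriv[OF assms(1)])
    obtain C where "\<forall>\<^sub>F q in nhds p. \<forall>s\<in>{0::real}. norm (start j q - start j p) \<le> C * norm (q - p)"
      using start unfolding calm_on_def by blast
    with eventually_in_P[OF assms(2)]
    have "\<forall>\<^sub>F q in nhds p. \<forall>s\<in>{0}. norm (state j q s - state j p s) \<le> C * norm (q - p)"
      by eventually_elim (simp add: assms(1,2))
    then show "calm_on {0} (state j) p"
      by (rule calm_onI)
  qed
qed

text \<open>Crossing a segment carries calmness from \<open>s = 0\<close> to \<open>s = 1\<close>,
  and the jump map carries it to the next start. The singleton \<open>{0}\<close> is a dummy domain:
  these values do not depend on \<open>s\<close>.\<close>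

lemma calm_start:
  assumes "p \<in> P"
  shows "j \<le> N \<Longrightarrow> calm_on {0::real} (\<lambda>p s. start j p) p"
proof (induction j)
  case 0
  then show ?case using initial_calm[OF assms] by simp
next
  case (Suc j)
  then have j: "j < N" "j \<le> N" by auto
  obtain C where "\<forall>\<^sub>F q in nhds p. \<forall>s\<in>{0..1}. norm (state j q s - state j p s) \<le> C * norm (q - p)"
    using calm_state_step[OF j(2) assms Suc.IH[OF j(2)]] unfolding calm_on_def by blast
  with eventually_in_P[OF assms]
  have "\<forall>\<^sub>F q in nhds p. \<forall>s\<in>{0::real}. norm (stop j q - stop j p) \<le> C * norm (q - p)"
  proof eventually_elim
    case (elim q)
    then have "norm (state j q 1 - state j p 1) \<le> C * norm (q - p)" by simp
    then show ?case using elim(1) assms j by simp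
  qed
  then have "calm_on {0::real} (\<lambda>p s. stop j p) p"
    by (rule calm_onI)
  then have "calm_on {0::real} (\<lambda>p s. J j (e (Suc j) p, stop j p, p)) p"
    using j assms
    by (intro calm_on_compose[OF J_lipschitz] calm_on_Pair event_time_calm calm_on_ident) auto
  then obtain D where "\<forall>\<^sub>F q in nhds p. \<forall>s\<in>{0::real}.
      norm (J j (e (Suc j) q, stop j q, q) - J j (e (Suc j) p, stop j p, p)) \<le> D * norm (q - p)"
    unfolding calm_on_def by blast
  with eventually_in_P[OF assms]
  have "\<forall>\<^sub>F q in nhds p. \<forall>s\<in>{0::real}. norm (start (Suc j) q - start (Suc j) p) \<le> D * norm (q - p)"
    by eventually_elim (simp add: jump[OF j(1)] assms)
  then show ?case by (rule calm_onI)
qed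

lemma calm_state: "j \<le> N \<Longrightarrow> p \<in> P \<Longrightarrow> calm_on {0..1} (state j) p"
  using calm_state_step calm_start by blast

lemma segment_end_le:
  assumes "p \<in> P"
  shows "j \<le> Suc N \<Longrightarrow> e j p \<le> e (Suc N) p"
proof (induction rule: inc_induct)
  case (step j)
  then show ?case using order[of j p] assms by simp
qed simp

lemma segment_start_ge:
  assumes "p \<in> P"
  shows "j \<le> Suc N \<Longrightarrow> e 0 p \<le> e j p"
proof (induction j)
  case (Suc j)
  then show ?case using order[of j p] assms by simp
qed simp

end

section \<open>Running cost along a flow with jumps\<close>

locale piecewise_flow_cost = piecewise_flow +
  fixes c :: "real \<times> 'b \<times> 'a \<Rightarrow> real"
  assumes c_lipschitz: "lipschitz_on_bounded c"
begin

definition cost :: "'a \<Rightarrow> real \<Rightarrow> real" where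
  "cost p t = integral {e 0 p..t} (\<lambda>s. c (s, y p s, p))"

text \<open>At \<open>s = 1\<close> on segment \<open>j\<close> and at \<open>s = 0\<close> on
  segment \<open>Suc j\<close> this is the running cost just before and just after event
  \<open>j\<close>, since \<open>state\<close> takes the one-sided limits there.\<close>

definition rate :: "nat \<Rightarrow> 'a \<Rightarrow> real \<Rightarrow> real" where
  "rate j p s = c (time j p s, state j p s, p)"

text \<open>On each segment the integrand agrees with a continuous function except possibly at the
  two ends, which integrability ignores; induction joins the segments.\<close>

lemma integrable_cost:
  assumes "p \<in> P"
  shows "(\<lambda>s. c (s, y p s, p)) integrable_on {e 0 p..e (Suc N) p}"
proof -
  have "(\<lambda>s. c (s, y p s, p)) integrable_on {e 0 p..e j p}" if "j \<le> Suc N" for j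
    using that
  proof (induction j)
    case (Suc j)
    then have j: "j \<le> N" by simp
    have "continuous_on {e j p..e (Suc j) p} (\<lambda>s. c (s, closed_seg j p s, p))"
      by (intro continuous_on_compose2[OF lipschitz_on_bounded_continuous_on[OF c_lipschitz, of UNIV]]
          continuous_intros continuous_on_closed_seg j assms) auto
    then have "(\<lambda>s. c (s, closed_seg j p s, p)) integrable_on {e j p..e (Suc j) p}"
      by (rule integrable_continuous_real)
    then have "(\<lambda>s. c (s, y p s, p)) integrable_on {e j p..e (Suc j) p}"
      by (rule integrable_spike_finite[of "{e j p, e (Suc j) p}", rotated 2])
        (auto simp: closed_seg_def)
    with Suc j show ?case
      using segment_start_ge[OF assms, of j] order[OF j assms]
      by - (rule Henstock_Kurzweil_Integration.integrable_combine[of "e 0 p" "e j p"], simp_all)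
  qed (use integrable_on_refl[of _ "e 0 p"] in simp)
  then show ?thesis by simp
qed

lemma continuous_on_cost:
  "p \<in> P \<Longrightarrow> continuous_on {e 0 p..e (Suc N) p} (cost p)"
  unfolding cost_def by (rule indefinite_integral_continuous_1[OF integrable_cost])

lemma continuous_on_rate: "j \<le> N \<Longrightarrow> p \<in> P \<Longrightarrow> continuous_on {0..1} (rate j p)"
  unfolding rate_def time_def
  by (intro continuous_on_compose2[OF lipschitz_on_bounded_continuous_on[OF c_lipschitz, of UNIV]]
      continuous_intros continuous_on_state) auto

lemma calm_rate: "j \<le> N \<Longrightarrow> p \<in> P \<Longrightarrow> calm_on {0..1} (rate j) p"
  unfolding rate_def
  by (intro calm_on_compose_compact[OF c_lipschitz] calm_on_Pair calm_time calm_state calm_on_ident)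
    (auto intro!: continuous_intros continuous_on_state simp: time_def)

text \<open>The fundamental theorem at an inner time \<open>t\<close> asks for continuity of the
  integrand at \<open>t\<close>; jumps before \<open>t\<close> do no harm to an integrable
  function.\<close>

lemma cost_deriv:
  assumes "j \<le> N" "p \<in> P" "0 < s" "s < 1"
  shows "((\<lambda>s. cost p (time j p s)) has_real_derivative len j p * rate j p s) (at s)"
proof -
  define t where "t = time j p s"
  have t: "e j p < t" "t < e (Suc j) p"
    unfolding t_def by (rule time_inside[OF assms])+
  then have t0: "e 0 p < t" "t < e (Suc N) p"
    using segment_start_ge[OF assms(2), of j] segment_end_le[OF assms(2), of "Suc j"] assms(1) by auto
  have "isCont (y p) t"
    using ode[OF assms(1,2) t] has_vector_derivative_continuous by blast
  then have "isCont (\<lambda>s. (s, y p s, p)) t"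
    by (intro continuous_intros)
  moreover have "isCont c x" for x
    using lipschitz_on_bounded_continuous_on[OF c_lipschitz, of UNIV] continuous_on_eq_continuous_at by blast
  ultimately have "isCont (\<lambda>s. c (s, y p s, p)) t"
    using isCont_o2 by blast
  then have "((\<lambda>u. integral {e 0 p..u} (\<lambda>s. c (s, y p s, p))) has_vector_derivative c (t, y p t, p))
      (at t within {e 0 p..e (Suc N) p} - {})"
    using t0
    by (intro integral_has_vector_derivative_continuous_at integrable_cost assms(2))
      (auto simp: continuous_at_imp_continuous_at_within)
  then have "(cost p has_real_derivative c (t, y p t, p)) (at t)"
    using t0 unfolding cost_def has_real_derivative_iff_has_vector_derivative
    by (simp add: at_within_Icc_at)
  moreover have "(time j p has_real_derivative len j p) (at s)"
    unfolding time_def by (auto intro!: derivative_eq_intros)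
  ultimately have "((\<lambda>s. cost p (time j p s)) has_real_derivative c (t, y p t, p) * len j p) (at s)"
    unfolding t_def by (rule DERIV_chain2)
  moreover have "y p t = state j p s"
    using t unfolding state_def closed_seg_def t_def[symmetric] by simp
  ultimately show ?thesis
    unfolding rate_def t_def by (simp add: mult.commute)
qed

lemma gderiv_cost_at_time:
  assumes j: "j \<le> N" and p: "p \<in> P" and s0: "s0 \<in> {0..1}"
    and endpoint: "GDERIV (\<lambda>q. time j q s0) p :> T"
    and fixed: "\<forall>\<^sub>F t in at (time j p s0) within {e j p<..<e (Suc j) p}. GDERIV (\<lambda>q. cost q t) p :> Z t"
    and lim: "(Z \<longlongrightarrow> Z0) (at (time j p s0) within {e j p<..<e (Suc j) p})"
  shows "GDERIV (\<lambda>q. cost q (time j q s0)) p :> Z0 + rate j p s0 *\<^sub>R T"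
proof -
  \<comment> \<open>Pulls limits in time back to the rescaled variable; as \<open>len j p\<close> is
    positive, punctured neighbourhoods stay punctured.\<close>
  have inner: "filterlim (time j p) (at (time j p s0) within {e j p<..<e (Suc j) p}) (at s0 within {0<..<1})"
    unfolding filterlim_at
  proof
    show "(time j p \<longlongrightarrow> time j p s0) (at s0 within {0<..<1})"
      unfolding time_def by (intro tendsto_intros)
    have "\<forall>\<^sub>F s in at s0 within {0<..<1}. s \<in> {0<..<1} \<and> s \<noteq> s0"
      by (simp add: eventually_at_filter)
    then show "\<forall>\<^sub>F s in at s0 within {0<..<1}. time j p s \<in> {e j p<..<e (Suc j) p} \<and> time j p s \<noteq> time j p s0"
    proof eventually_elim
      case (elim s)
      then show ?case
        using time_inside[OF j p, of s] len_pos[OF j p] by (auto simp: time_def)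
    qed
  qed
  show ?thesis
  proof (rule gderiv_moving_endpoint[where \<phi> = "time j" and z = cost and k = "rate j" and
        a = "e j" and l = "len j" and Z = "\<lambda>s. Z (time j p s)"])
    show "time j q s = e j q + s * len j q" for q s
      by (rule time_def)
    show "\<forall>\<^sub>F q in nhds p. continuous_on {0..1} (\<lambda>s. cost q (time j q s))"
      using eventually_in_P[OF p]
    proof eventually_elim
      case (elim q)
      show ?case
      proof (rule continuous_on_compose2[OF continuous_on_cost[OF elim]])
        show "continuous_on {0..1} (time j q)"
          unfolding time_def by (intro continuous_intros)
        show "time j q ` {0..1} \<subseteq> {e 0 q..e (Suc N) q}"
          using time_closed[OF j elim] segment_start_ge[OF elim, of j]
            segment_end_le[OF elim, of "Suc j"] j by fastforce
      qed
    qed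
    show "\<forall>\<^sub>F q in nhds p. \<forall>s. 0 < s \<longrightarrow> s < 1 \<longrightarrow>
        ((\<lambda>s. cost q (time j q s)) has_real_derivative len j q * rate j q s) (at s)"
      using eventually_in_P[OF p] by eventually_elim (use cost_deriv[OF j] in blast)
    show "\<forall>\<^sub>F s in at s0 within {0<..<1}. GDERIV (\<lambda>q. cost q (time j p s)) p :> Z (time j p s)"
      using eventually_compose_filterlim[OF fixed inner] .
    show "((\<lambda>s. Z (time j p s)) \<longlongrightarrow> Z0) (at s0 within {0<..<1})"
      by (rule filterlim_compose[OF lim inner])
  qed (rule calm_rate[OF j p] continuous_on_rate[OF j p] calm_time[OF j p] calm_len[OF j p]
      len_pos[OF j p] s0 endpoint)+
qed

lemma gradient_jump_at_event:
  assumes j: "j < N" and p: "p \<in> P"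
    and endpoint: "GDERIV (e (Suc j)) p :> T"
    and fixed: "\<forall>\<^sub>F t in at (e (Suc j) p). GDERIV (\<lambda>q. cost q t) p :> Z t"
    and lim: "(Z \<longlongrightarrow> Zm) (at_left (e (Suc j) p))" "(Z \<longlongrightarrow> Zp) (at_right (e (Suc j) p))"
  shows "Zp = Zm - (c (e (Suc j) p, start (Suc j) p, p) - c (e (Suc j) p, stop j p, p)) *\<^sub>R T"
proof -
  have j': "j \<le> N" "Suc j \<le> N" using j by auto
  \<comment> \<open>The far end of either segment lies at positive distance, so approaching the
    event within a segment is a plain one-sided limit.\<close>
  have left: "at (e (Suc j) p) within {e j p<..<e (Suc j) p} = at_left (e (Suc j) p)"
    using order[OF j'(1) p] by (intro at_within_nhd[where S = "{e j p<..}"]) auto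
  have right: "at (e (Suc j) p) within {e (Suc j) p<..<e (Suc (Suc j)) p} = at_right (e (Suc j) p)"
    using order[OF j'(2) p] by (intro at_within_nhd[where S = "{..<e (Suc (Suc j)) p}"]) auto
  have "\<forall>\<^sub>F t in at_left (e (Suc j) p). GDERIV (\<lambda>q. cost q t) p :> Z t"
    "\<forall>\<^sub>F t in at_right (e (Suc j) p). GDERIV (\<lambda>q. cost q t) p :> Z t"
    using fixed eventually_at_split by blast+
  \<comment> \<open>\<open>time j q 1\<close> and \<open>time (Suc j) q 0\<close> are both
    \<open>e (Suc j) q\<close>, so the two segments yield gradients of the same function.\<close>
  then have "GDERIV (\<lambda>q. cost q (e (Suc j) q)) p :> Zm + rate j p 1 *\<^sub>R T"
    "GDERIV (\<lambda>q. cost q (e (Suc j) q)) p :> Zp + rate (Suc j) p 0 *\<^sub>R T"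
    using gderiv_cost_at_time[OF j'(1) p, of 1] gderiv_cost_at_time[OF j'(2) p, of 0]
      endpoint lim left right by simp_all
  then have "(\<lambda>h. h \<bullet> (Zm + rate j p 1 *\<^sub>R T)) = (\<lambda>h. h \<bullet> (Zp + rate (Suc j) p 0 *\<^sub>R T))"
    unfolding gderiv_def by (rule has_derivative_unique)
  then have "Zm + rate j p 1 *\<^sub>R T = Zp + rate (Suc j) p 0 *\<^sub>R T"
    by (metis inner_commute vector_eq_ldot)
  then show ?thesis
    using j' p by (simp add: rate_def algebra_simps)
qed

end

subsection \<open>Hybrid mechanical systems\<close>

lemma bounded_bilinear_matrix_vector_mult:
  "bounded_bilinear ((*v) :: real^'n^'m \<Rightarrow> real^'n \<Rightarrow> real^'m)"
  unfolding bilinear_conv_bounded_bilinear[symmetric] bilinear_def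
  by (auto intro!: linearI simp: matrix_vector_mult_add_rdistrib matrix_vector_right_distrib
      scaleR_matrix_vector_assoc matrix_vector_mult_scaleR)

context hybrid_mechanical_system
begin

definition seg_time :: "nat \<Rightarrow> real^'p \<Rightarrow> real" where
  "seg_time j p = (case j of 0 \<Rightarrow> t0 | Suc i \<Rightarrow> if i < N then te i p else tF)"

definition traj :: "real^'p \<Rightarrow> real \<Rightarrow> (real^'n) \<times> (real^'n)" where
  "traj p t = (q t p, v t p)"

text \<open>Segment 0 starts from the initial data, so that differentiability of \<open>q0\<close>
  and \<open>v0\<close> gives calmness of the start at once; later starts are limits because
  \<open>v\<close> is unconstrained at event times.\<close>

definition seg_start :: "nat \<Rightarrow> real^'p \<Rightarrow> (real^'n) \<times> (real^'n)" where
  "seg_start j p = (if j = 0 then (q0 p, v0 p) else Lim (at_right (seg_time j p)) (traj p))"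

definition seg_stop :: "nat \<Rightarrow> real^'p \<Rightarrow> (real^'n) \<times> (real^'n)" where
  "seg_stop j p = Lim (at_left (seg_time (Suc j) p)) (traj p)"

definition vector_field :: "real \<times> ((real^'n) \<times> (real^'n)) \<times> (real^'p) \<Rightarrow> (real^'n) \<times> (real^'n)" where
  "vector_field = (\<lambda>(t, (x, w), p). (w, f_eom M F t x w p))"

definition reset :: "nat \<Rightarrow> real \<times> ((real^'n) \<times> (real^'n)) \<times> (real^'p) \<Rightarrow> (real^'n) \<times> (real^'n)" where
  "reset i = (\<lambda>(t, (x, w), p). (x, h i t x w p))"

lemma seg_time_simps [simp]:
  "seg_time 0 p = t0" "i < N \<Longrightarrow> seg_time (Suc i) p = te i p" "seg_time (Suc N) p = tF"
  unfolding seg_time_def by auto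

lemma seg_time_order: "j \<le> N \<Longrightarrow> p \<in> P \<Longrightarrow> seg_time j p < seg_time (Suc j) p"
  using time_order event_in_range events_ordered[of "j - 1" j p]
  by (auto simp: seg_time_def split: nat.splits)

lemma seg_time_range:
  assumes "j \<le> Suc N" "p \<in> P"
  shows "seg_time j p \<in> {t0..tF}"
  using time_order event_in_range[OF _ assms(2)]
  by (fastforce simp: seg_time_def less_imp_le split: nat.splits)

lemma seg_time_less: "p \<in> P \<Longrightarrow> j \<le> Suc N \<Longrightarrow> i < j \<Longrightarrow> seg_time i p < seg_time j p"
proof (induction j)
  case (Suc j)
  then show ?case
    using seg_time_order[of j p] by (cases "i = j") auto
qed simp

text \<open>Each event time is some \<open>seg_time (Suc i)\<close>, and monotonicity in the index
  puts it at or before the start of the segment, or at or after its end.\<close>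

lemma not_event:
  assumes "j \<le> N" "p \<in> P" "seg_time j p < t" "t < seg_time (Suc j) p" "i < N"
  shows "t \<noteq> te i p"
proof (cases "Suc i \<le> j")
  case True
  then have "seg_time (Suc i) p \<le> seg_time j p"
    using seg_time_less[OF assms(2), of j "Suc i"] assms(1) by (cases "Suc i = j") auto
  then show ?thesis using assms by simp
next
  case False
  then have "seg_time (Suc j) p \<le> seg_time (Suc i) p"
    using seg_time_less[OF assms(2), of "Suc i" "Suc j"] assms(5) by (cases "i = j") auto
  then show ?thesis using assms by simp
qed

lemma traj_deriv:
  assumes "p \<in> P" "t \<in> {t0..tF}" "\<And>i. i < N \<Longrightarrow> t \<noteq> te i p"
  shows "(traj p has_vector_derivative vector_field (t, traj p t, p)) (at t within {t0..tF})"
  unfolding traj_def [abs_def] vector_field_def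
  using position_eom[OF assms] velocity_eom[OF assms]
  by (simp add: has_vector_derivative_Pair)

lemma traj_continuous:
  assumes "p \<in> P" "t \<in> {t0..tF}" "\<And>i. i < N \<Longrightarrow> t \<noteq> te i p"
  shows "(traj p \<longlongrightarrow> traj p t) (at t within {t0..tF})"
  using has_vector_derivative_continuous[OF traj_deriv[OF assms]]
  by (simp add: continuous_within)

lemma position_tendsto:
  assumes "i < N" "p \<in> P"
  shows "((\<lambda>t. q t p) \<longlongrightarrow> q (te i p) p) (at (te i p))"
proof -
  have "isCont (\<lambda>t. q t p) (te i p)"
    using continuous_on_interior[OF position_continuous[OF assms(2)]] event_in_range[OF assms] by simp
  then show ?thesis by (simp add: isCont_def)
qed

lemma traj_before_event:
  assumes "i < N" "p \<in> P" "((\<lambda>t. v t p) \<longlongrightarrow> w) (at_left (te i p))"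
  shows "(traj p \<longlongrightarrow> (q (te i p) p, w)) (at_left (te i p))"
  unfolding traj_def [abs_def]
  by (intro tendsto_Pair assms(3) tendsto_within_subset[OF position_tendsto[OF assms(1,2)]]) simp

lemma traj_after_event:
  assumes "i < N" "p \<in> P" "((\<lambda>t. v t p) \<longlongrightarrow> w) (at_right (te i p))"
  shows "(traj p \<longlongrightarrow> (q (te i p) p, w)) (at_right (te i p))"
  unfolding traj_def [abs_def]
  by (intro tendsto_Pair assms(3) tendsto_within_subset[OF position_tendsto[OF assms(1,2)]]) simp

lemma seg_stop_event:
  assumes "i < N" "p \<in> P" "((\<lambda>t. v t p) \<longlongrightarrow> w) (at_left (te i p))"
  shows "seg_stop i p = (q (te i p) p, w)"
  using tendsto_Lim[OF _ traj_before_event[OF assms]] assms(1) by (simp add: seg_stop_def)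

lemma seg_start_event:
  assumes "i < N" "p \<in> P" "((\<lambda>t. v t p) \<longlongrightarrow> w) (at_right (te i p))"
  shows "seg_start (Suc i) p = (q (te i p) p, w)"
  using tendsto_Lim[OF _ traj_after_event[OF assms]] assms(1) by (simp add: seg_start_def)

lemma tendsto_seg_start:
  assumes "j \<le> N" "p \<in> P"
  shows "(traj p \<longlongrightarrow> seg_start j p) (at_right (seg_time j p))"
proof (cases j)
  case 0
  \<comment> \<open>As no event happens at \<open>t0\<close>, the equations of motion hold there
    one-sidedly and give right continuity of the trajectory.\<close>
  have "t0 \<noteq> te i p" if "i < N" for i
    using event_in_range[OF that assms(2)] by simp
  then have "(traj p \<longlongrightarrow> traj p t0) (at t0 within {t0..tF})"
    using time_order by (intro traj_continuous assms(2)) auto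
  then show ?thesis
    using 0 init[OF assms(2)] time_order by (simp add: seg_start_def traj_def at_within_Icc_at_right)
next
  case (Suc i)
  then have i: "i < N" using assms(1) by simp
  obtain w where w: "((\<lambda>t. v t p) \<longlongrightarrow> w) (at_right (te i p))"
    using event_transition[OF i assms(2)] by blast
  show ?thesis
    using traj_after_event[OF i assms(2) w] seg_start_event[OF i assms(2) w] Suc i by simp
qed

lemma tendsto_seg_stop:
  assumes "j \<le> N" "p \<in> P"
  shows "(traj p \<longlongrightarrow> seg_stop j p) (at_left (seg_time (Suc j) p))"
proof (cases "j < N")
  case False
  then have j: "j = N" using assms(1) by simp
  have "tF \<noteq> te i p" if "i < N" for i
    using event_in_range[OF that assms(2)] by simp
  then have "(traj p \<longlongrightarrow> traj p tF) (at tF within {t0..tF})"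
    using time_order by (intro traj_continuous assms(2)) auto
  then have *: "(traj p \<longlongrightarrow> traj p tF) (at_left tF)"
    using time_order by (simp add: at_within_Icc_at_left)
  then have "seg_stop j p = traj p tF"
    unfolding seg_stop_def j by (simp add: tendsto_Lim)
  then show ?thesis
    using * j by simp
next
  case True
  obtain w where w: "((\<lambda>t. v t p) \<longlongrightarrow> w) (at_left (te j p))"
    using event_transition[OF True assms(2)] by blast
  show ?thesis
    using traj_before_event[OF True assms(2) w] seg_stop_event[OF True assms(2) w] True by simp
qed

lemma seg_start_reset:
  assumes "i < N" "p \<in> P"
  shows "seg_start (Suc i) p = reset i (seg_time (Suc i) p, seg_stop i p, p)"
proof -
  obtain w where "((\<lambda>t. v t p) \<longlongrightarrow> w) (at_left (te i p))"
    "((\<lambda>t. v t p) \<longlongrightarrow> h i (te i p) (q (te i p) p) w p) (at_right (te i p))"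
    using event_transition[OF assms] by blast
  then show ?thesis
    using seg_start_event[OF assms] seg_stop_event[OF assms] assms by (simp add: reset_def)
qed

section \<open>Lipschitz regularity of the mechanical data\<close>

lemmas bounded_linear_projections =
  bounded_linear_Pair bounded_linear_fst bounded_linear_snd
  bounded_linear_compose[OF bounded_linear_fst] bounded_linear_compose[OF bounded_linear_snd]

lemma f_eom_lipschitz:
  "lipschitz_on_bounded (\<lambda>z::real \<times> ((real^'n) \<times> (real^'n)) \<times> (real^'p).
    f_eom M F (fst z) (fst (fst (snd z))) (snd (fst (snd z))) (snd (snd z)))"
proof -
  \<comment> \<open>Applying the smooth function to an explicit tuple of projections exhibits a
    composition with a linear map, which regroups the layout (time, state, parameter) of
    \<open>piecewise_flow\<close>.\<close>
  have "lipschitz_on_bounded (\<lambda>z::real \<times> ((real^'n) \<times> (real^'n)) \<times> (real^'p).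
      (\<lambda>(t, x, p). matrix_inv (M t x p)) (fst z, fst (fst (snd z)), snd (snd z)))"
    by (intro lipschitz_on_bounded_compose[OF smooth_lipschitz_on_bounded[OF mass_inv_smooth]]
        lipschitz_on_bounded_linear bounded_linear_projections)
  moreover have "lipschitz_on_bounded (\<lambda>z::real \<times> ((real^'n) \<times> (real^'n)) \<times> (real^'p).
      (\<lambda>(t, x, w, p). F t x w p) (fst z, fst (fst (snd z)), snd (fst (snd z)), snd (snd z)))"
    by (intro lipschitz_on_bounded_compose[OF smooth_lipschitz_on_bounded[OF force_smooth]]
        lipschitz_on_bounded_linear bounded_linear_projections)
  ultimately show ?thesis
    unfolding f_eom_def prod.case
    by (rule lipschitz_on_bounded_bilinear_compose[OF bounded_bilinear_matrix_vector_mult])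
qed

lemma vector_field_lipschitz: "lipschitz_on_bounded vector_field"
  unfolding vector_field_def case_prod_unfold
  by (intro lipschitz_on_bounded_Pair f_eom_lipschitz lipschitz_on_bounded_linear
      bounded_linear_projections)

lemma reset_lipschitz:
  assumes "i < N"
  shows "lipschitz_on_bounded (reset i)"
proof -
  have h: "lipschitz_on_bounded (\<lambda>z::real \<times> ((real^'n) \<times> (real^'n)) \<times> (real^'p).
      (\<lambda>(t, x, w, p). h i t x w p) (fst z, fst (fst (snd z)), snd (fst (snd z)), snd (snd z)))"
    by (intro lipschitz_on_bounded_compose[OF smooth_lipschitz_on_bounded[OF jump_smooth[OF assms]]]
        lipschitz_on_bounded_linear bounded_linear_projections)
  show ?thesis
    unfolding reset_def case_prod_unfold
    by (intro lipschitz_on_bounded_Pair h[unfolded case_prod_unfold prod.sel]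
        lipschitz_on_bounded_linear bounded_linear_projections)
qed

lemma g_tilde_lipschitz:
  assumes "smooth (\<lambda>(t, x, w, a, p). g t x w a p)"
  shows "lipschitz_on_bounded (\<lambda>(t, (x, w), p). g_tilde M F g t x w p)"
proof -
  have "lipschitz_on_bounded (\<lambda>z::real \<times> ((real^'n) \<times> (real^'n)) \<times> (real^'p).
      (\<lambda>(t, x, w, a, p). g t x w a p) (fst z, fst (fst (snd z)), snd (fst (snd z)),
        f_eom M F (fst z) (fst (fst (snd z))) (snd (fst (snd z))) (snd (snd z)), snd (snd z)))"
    by (intro lipschitz_on_bounded_compose[OF smooth_lipschitz_on_bounded[OF assms]]
        lipschitz_on_bounded_Pair f_eom_lipschitz)
      (intro lipschitz_on_bounded_linear bounded_linear_projections)+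
  then show ?thesis
    unfolding g_tilde_def case_prod_unfold prod.sel .
qed

lemma differentiable_at_param: "f differentiable_on P \<Longrightarrow> p \<in> P \<Longrightarrow> f differentiable (at p)"
  using params_open differentiable_on_eq_differentiable_at by blast

lemma seg_time_calm:
  assumes "j \<le> Suc N" "p \<in> P"
  shows "calm_on S (\<lambda>p s. seg_time j p) p"
proof (cases "\<exists>i<N. j = Suc i")
  case True
  then obtain i where i: "i < N" "j = Suc i" by blast
  have "calm_on S (\<lambda>p s. te i p) p"
    by (intro calm_on_differentiable differentiable_at_param event_time_differentiable i assms(2))
  then show ?thesis using i by simp
next
  case False
  then have "\<exists>c. \<forall>p. seg_time j p = c"
    unfolding seg_time_def by (auto split: nat.splits)
  then show ?thesis
    using calm_on_const by auto
qed

lemma flow: "piecewise_flow N P seg_time traj seg_start seg_stop vector_field reset"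
proof
  fix j p t
  assume j: "j \<le> N" "p \<in> P" and t: "seg_time j p < t" "t < seg_time (Suc j) p"
  then have "t0 < t" "t < tF"
    using seg_time_range[of j p] seg_time_range[of "Suc j" p] by auto
  then show "(traj p has_vector_derivative vector_field (t, traj p t, p)) (at t)"
    using traj_deriv[OF j(2), of t] not_event[OF j t] by (simp add: at_within_Icc_at)
next
  fix p assume "p \<in> P"
  then have "calm_on {0::real} (\<lambda>p s. (q0 p, v0 p)) p"
    by (intro calm_on_Pair calm_on_differentiable differentiable_at_param init_differentiable)
  then show "calm_on {0::real} (\<lambda>p s. seg_start 0 p) p"
    by (simp add: seg_start_def)
qed (fact params_open | blast intro: seg_time_order tendsto_seg_start tendsto_seg_stop seg_start_reset
    vector_field_lipschitz reset_lipschitz seg_time_calm)+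

end

theorem theorem5:
  fixes M :: "real \<Rightarrow> real^'n \<Rightarrow> real^'p \<Rightarrow> real^'n^'n"
    and F :: "real \<Rightarrow> real^'n \<Rightarrow> real^'n \<Rightarrow> real^'p \<Rightarrow> real^'n"
    and g :: "real \<Rightarrow> real^'n \<Rightarrow> real^'n \<Rightarrow> real^'n \<Rightarrow> real^'p \<Rightarrow> real"
    and t0 tF :: real
    and P :: "(real^'p) set"
    and q0 v0 :: "real^'p \<Rightarrow> real^'n"
    and N k :: nat
    and r :: "nat \<Rightarrow> real^'n \<Rightarrow> real"
    and h :: "nat \<Rightarrow> real \<Rightarrow> real^'n \<Rightarrow> real^'n \<Rightarrow> real^'p \<Rightarrow> real^'n"
    and te :: "nat \<Rightarrow> real^'p \<Rightarrow> real"
    and q v :: "real \<Rightarrow> real^'p \<Rightarrow> real^'n"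
    and \<rho> :: "real^'p"
    and Z :: "real \<Rightarrow> real^'p"
    and Zm Zp dte :: "real^'p"
    and vm vp :: "real^'n"
  assumes system: "hybrid_mechanical_system M F t0 tF P q0 v0 N r h te q v"
    and cost_smooth: "smooth (\<lambda>(t, x, w, a, \<rho>). g t x w a \<rho>)"
    and param: "\<rho> \<in> P"
    and event: "k < N"
    and event_time_derivative: "GDERIV (te k) \<rho> :> dte"
    and velocity_before: "((\<lambda>t. v t \<rho>) \<longlongrightarrow> vm) (at_left (te k \<rho>))"
    and velocity_after: "((\<lambda>t. v t \<rho>) \<longlongrightarrow> vp) (at_right (te k \<rho>))"
    and sensitivity: "\<forall>\<^sub>F t in at (te k \<rho>). GDERIV (quadrature M F g t0 q v t) \<rho> :> Z t"
    and sensitivity_before: "(Z \<longlongrightarrow> Zm) (at_left (te k \<rho>))"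
    and sensitivity_after: "(Z \<longlongrightarrow> Zp) (at_right (te k \<rho>))"
  shows "Zp = Zm -
    (g_tilde M F g (te k \<rho>) (q (te k \<rho>) \<rho>) vp \<rho> -
     g_tilde M F g (te k \<rho>) (q (te k \<rho>) \<rho>) vm \<rho>) *\<^sub>R dte"
proof -
  interpret hybrid_mechanical_system M F t0 tF P q0 v0 N r h te q v
    by (rule system)
  define c where "c = (\<lambda>(t, (x, w), p). g_tilde M F g t x w p)"
  interpret piecewise_flow_cost N P seg_time traj seg_start seg_stop vector_field reset c
    unfolding piecewise_flow_cost_def piecewise_flow_cost_axioms_def
    using flow g_tilde_lipschitz[OF cost_smooth] by (simp add: c_def)
  have [simp]: "seg_time (Suc k) = te k"
    using event by (simp add: fun_eq_iff)
  \<comment> \<open>\<open>traj\<close> keeps the values of \<open>v\<close> at event times, so both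
    integrals have literally the same integrand.\<close>
  have cost: "(\<lambda>p. cost p t) = quadrature M F g t0 q v t" for t
    unfolding cost_def quadrature_def by (simp add: c_def traj_def)
  have c: "c (t, (x, w), p) = g_tilde M F g t x w p" for t x w p
    by (simp add: c_def)
  show ?thesis
    using gradient_jump_at_event[OF event param, of dte Z Zm Zp] event_time_derivative sensitivity
      sensitivity_before sensitivity_after seg_start_event[OF event param velocity_after]
      seg_stop_event[OF event param velocity_before]
    by (simp add: cost c)
qed

end
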